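(* Let $\Omega=\Omega_1\times\dots\times\Omega_K$ with each $\Omega_k\subseteq\mathbb{R}^{n_k}$ a non-empty polyhedron, let $x^0\in\Omega$, and let $\{x^l\},\{z^l\}$ be the sequences of iterates and of Cauchy points generated from $x^0$ by the trust region algorithm with alternating projections (TRAP) described in the context. Assume that (i) $L$ is bounded below on $\{x\in\Omega: L(x)\le L(x^0)\}$; (ii) $L$ is continuously differentiable in an open set containing $\Omega$ and its gradient $\nabla L$ is uniformly continuous; (iii) there exists $\hat B>0$ such that $\|B(x)\|_2\le\hat B$ for all $x\in\Omega$. If $x^{\ast}$ is a limit point of $\{x^l\}$, then there exists a subsequence of indices $\{l_i\}$ such that $$\lim_{i\to+\infty}\|\nabla_\Omega L(z^{l_i})\|_2=0\qquad\text{and}\qquad z^{l_i}\to x^{\ast}.$$ Moreover, $\nabla_\Omega L(x^{\ast})=0$, meaning that $x^{\ast}$ is a critical point of $L+\iota_\Omega$.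
   Context: Notation. $x=(x_1^\top,\dots,x_K^\top)^\top\in\mathbb{R}^n$ with $x_k\in\mathbb{R}^{n_k}$, $n=\sum_k n_k$. $\Omega_k=\{x_k\in\mathbb{R}^{n_k}:\langle\omega_{k,i},x_k\rangle\le h_{k,i},\ i=1,\dots,m_k\}$. $\iota_\Omega$ is the indicator function of $\Omega$ ($0$ on $\Omega$, $+\infty$ outside). $P_S$ is the Euclidean projection onto the closed convex set $S$. $\mathcal{A}_{\Omega_k}(x_k)$ is the set of indices $i$ of constraints of $\Omega_k$ active at $x_k$. $\mathcal{T}_\Omega(x)$ is the tangent cone to $\Omega$ at $x$. $g(x)=\nabla L(x)$. The projected gradient is $\nabla_\Omega L(x):=P_{\mathcal{T}_\Omega(x)}(-g(x))$; $x\in\Omega$ is a critical point of $L+\iota_\Omega$ iff $\nabla_\Omega L(x)=0$. Model. At an iterate $x\in\Omega$, with $B(x)\in\mathbb{R}^{n\times n}$ symmetric, $$m(x'):=L(x)+\langle g(x),x'-x\rangle+\tfrac12\langle x'-x,B(x)(x'-x)\rangle .$$ TRAP. Fixed parameters: initial radius $\Delta^0>0$; $0<\sigma_1<\sigma_2<1<\sigma_3$; $0<\eta_1<\eta_2<1$; $\gamma_1\in(0,1)$, $\gamma_2>0$; $\nu_0\in(0,1)$, $0<\nu_1<\nu_2$, $\nu_3,\nu_4,\nu_5>0$; $0<\underline\sigma<\bar\sigma$. One iteration from $x=x^l\in\Omega$ with radius $\Delta=\Delta^l>0$: (1) Cauchy point. For $k=1,\dots,K$ in order, let $m_k(u):=m(z_1,\dots,z_{k-1},u,x_{k+1},\dots,x_K)$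 for $u\in\mathbb{R}^{n_k}$, $z_k(\alpha):=P_{\Omega_k}(x_k-\alpha\nabla m_k(x_k))$, and $z_k:=z_k(\alpha_k)$, where $\alpha_k>0$ satisfies: (a) $m_k(z_k)\le m_k(x_k)+\nu_0\langle\nabla m_k(x_k),z_k-x_k\rangle$ and $\|z_k-x_k\|_\infty\le\nu_2\Delta$; (b) $\alpha_k\in[\nu_4,\nu_5]$, or $\alpha_k\in[\nu_3\bar\alpha_k,\nu_5]$ for some $\bar\alpha_k>0$ such that $m_k(z_k(\bar\alpha_k))>m_k(x_k)+\nu_0\langle\nabla m_k(x_k),z_k(\bar\alpha_k)-x_k\rangle$ or $\|z_k(\bar\alpha_k)-x_k\|_\infty\ge\nu_1\Delta$. The Cauchy point is $z=z^l:=(z_1^\top,\dots,z_K^\top)^\top$. (2) Refinement. Find $y=y^l\in\Omega$ with $m(x)-m(y)\ge\gamma_1(m(x)-m(z))$, $\|y-x\|_\infty\le\gamma_2\Delta$, $\mathcal{A}_{\Omega_k}(z_k)\subseteq\mathcal{A}_{\Omega_k}(y_k)$ for all $k$. It is obtained by a monotone (safeguarded conjugate gradient) method started at $z$ on the regularised objective $m(y)+\frac{\sigma^l}{2}\|y-z\|_2^2$ with $\sigma^l\in(\underline\sigma,\bar\sigma)$, so that $m(y)+\frac{\sigma^l}{2}\|y-z\|_2^2\le m(z)$. (3) Update. $\rho^l:=\frac{L(x)-L(y)}{m(x)-m(y)}$. If $\rho^l<\eta_1$: $x^{l+1}=x^l$, $\Delta^{l+1}\in[\sigma_1\Delta^l,\sigma_2\Delta^l]$.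 If $\rho^l\in[\eta_1,\eta_2]$: $x^{l+1}=y^l$, $\Delta^{l+1}\in[\sigma_1\Delta^l,\sigma_3\Delta^l]$. If $\rho^l>\eta_2$: $x^{l+1}=y^l$, $\Delta^{l+1}\in[\Delta^l,\sigma_3\Delta^l]$. The stopping tolerance is taken to be $0$ and no iterate is critical, so that infinite sequences are generated. *)

theory Defs
  imports "HOL-Analysis.Analysis"
begin

definition gradient :: "('a::real_inner \<Rightarrow> real) \<Rightarrow> 'a \<Rightarrow> 'a" where
  "gradient f x = (THE D. GDERIV f x :> D)"

text \<open>The tangent cone of a convex set: the closure of the cone of feasible directions.\<close>

definition tangent_cone :: "'a::real_normed_vector set \<Rightarrow> 'a \<Rightarrow> 'a set" where
  "tangent_cone S x = closure (cone hull ((\<lambda>y. y - x) ` S))"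

definition projected_gradient ::
    "('a::{real_inner,heine_borel} \<Rightarrow> real) \<Rightarrow> 'a set \<Rightarrow> 'a \<Rightarrow> 'a" where
  "projected_gradient L S x = closest_point (tangent_cone S x) (- gradient L x)"

text \<open>Criticality is meant for \<open>L\<close> plus the indicator function (with values 0 and infinity) of \<open>S\<close>.\<close>

definition critical_point ::
    "('a::{real_inner,heine_borel} \<Rightarrow> real) \<Rightarrow> 'a set \<Rightarrow> 'a \<Rightarrow> bool" where
  "critical_point L S x \<longleftrightarrow> x \<in> S \<and> projected_gradient L S x = 0"

text \<open>
  The block structure of \<open>real ^ 'n\<close>, with \<open>n = CARD('n)\<close>, is given by a map \<open>blk\<close> sending every
  coordinate to the number of its block in \<open>{1..K}\<close>.  The factor of block \<open>k\<close>, whose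
  dimension is the number of coordinates \<open>j\<close> with \<open>blk j = k\<close>, is identified with the subspace
  of the vectors vanishing outside block \<open>k\<close>; inner product, Euclidean norm and maximum norm
  of the factor are the restrictions of those of \<open>real ^ 'n\<close>.
\<close>

definition block_space :: "('n::finite \<Rightarrow> nat) \<Rightarrow> nat \<Rightarrow> (real ^ 'n) set" where
  "block_space blk k = {u. \<forall>j. blk j \<noteq> k \<longrightarrow> u $ j = 0}"

definition block :: "('n::finite \<Rightarrow> nat) \<Rightarrow> nat \<Rightarrow> real ^ 'n \<Rightarrow> real ^ 'n" where
  "block blk k x = (\<chi> j. if blk j = k then x $ j else 0)"

definition block_polyhedron ::
    "('n::finite \<Rightarrow> nat) \<Rightarrow> (nat \<Rightarrow> nat) \<Rightarrow> (nat \<Rightarrow> nat \<Rightarrow> real ^ 'n) \<Rightarrow> (nat \<Rightarrow> nat \<Rightarrow> real)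
      \<Rightarrow> nat \<Rightarrow> (real ^ 'n) set" where
  "block_polyhedron blk nc \<omega> h k =
     {u \<in> block_space blk k. \<forall>i\<in>{1..nc k}. \<omega> k i \<bullet> u \<le> h k i}"

definition active_set ::
    "(nat \<Rightarrow> nat) \<Rightarrow> (nat \<Rightarrow> nat \<Rightarrow> real ^ 'n::finite) \<Rightarrow> (nat \<Rightarrow> nat \<Rightarrow> real)
      \<Rightarrow> nat \<Rightarrow> real ^ 'n \<Rightarrow> nat set" where
  "active_set nc \<omega> h k u = {i \<in> {1..nc k}. \<omega> k i \<bullet> u = h k i}"

definition feasible_set ::
    "nat \<Rightarrow> ('n::finite \<Rightarrow> nat) \<Rightarrow> (nat \<Rightarrow> nat) \<Rightarrow> (nat \<Rightarrow> nat \<Rightarrow> real ^ 'n)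
      \<Rightarrow> (nat \<Rightarrow> nat \<Rightarrow> real) \<Rightarrow> (real ^ 'n) set" where
  "feasible_set K blk nc \<omega> h = {x. \<forall>k\<in>{1..K}. block blk k x \<in> block_polyhedron blk nc \<omega> h k}"

definition model ::
    "(real ^ 'n::finite \<Rightarrow> real) \<Rightarrow> (real ^ 'n \<Rightarrow> real ^ 'n ^ 'n) \<Rightarrow> real ^ 'n \<Rightarrow> real ^ 'n \<Rightarrow> real" where
  "model L B x x' = L x + gradient L x \<bullet> (x' - x) + 1 / 2 * ((x' - x) \<bullet> (B x *v (x' - x)))"

text \<open>
  The function \<open>u \<mapsto> m(z\<^sub>1, \<dots>, z\<^sub>k\<^sub>-\<^sub>1, u, x\<^sub>k\<^sub>+\<^sub>1, \<dots>, x\<^sub>K)\<close>.  It depends on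
  the block \<open>k\<close> of \<open>u\<close> only, so its gradient lies in \<open>block_space blk k\<close> and is the gradient
  of its restriction to that subspace.
\<close>

definition block_model ::
    "('n::finite \<Rightarrow> nat) \<Rightarrow> nat \<Rightarrow> (real ^ 'n \<Rightarrow> real) \<Rightarrow> real ^ 'n \<Rightarrow> real ^ 'n \<Rightarrow> real ^ 'n \<Rightarrow> real" where
  "block_model blk k m z x u =
     m (\<chi> j. if blk j < k then z $ j else if blk j = k then u $ j else x $ j)"

record trap_params =
  \<sigma>\<^sub>1 :: real
  \<sigma>\<^sub>2 :: real
  \<sigma>\<^sub>3 :: real
  \<eta>\<^sub>1 :: real
  \<eta>\<^sub>2 :: real
  \<gamma>\<^sub>1 :: real
  \<gamma>\<^sub>2 :: real
  \<nu>\<^sub>0 :: real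
  \<nu>\<^sub>1 :: real
  \<nu>\<^sub>2 :: real
  \<nu>\<^sub>3 :: real
  \<nu>\<^sub>4 :: real
  \<nu>\<^sub>5 :: real
  \<sigma>_low :: real
  \<sigma>_up :: real

definition valid_params :: "trap_params \<Rightarrow> bool" where
  "valid_params p \<longleftrightarrow>
     0 < \<sigma>\<^sub>1 p \<and> \<sigma>\<^sub>1 p < \<sigma>\<^sub>2 p \<and> \<sigma>\<^sub>2 p < 1 \<and> 1 < \<sigma>\<^sub>3 p \<and>
     0 < \<eta>\<^sub>1 p \<and> \<eta>\<^sub>1 p < \<eta>\<^sub>2 p \<and> \<eta>\<^sub>2 p < 1 \<and>
     0 < \<gamma>\<^sub>1 p \<and> \<gamma>\<^sub>1 p < 1 \<and> 0 < \<gamma>\<^sub>2 p \<and>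
     0 < \<nu>\<^sub>0 p \<and> \<nu>\<^sub>0 p < 1 \<and> 0 < \<nu>\<^sub>1 p \<and> \<nu>\<^sub>1 p < \<nu>\<^sub>2 p \<and>
     0 < \<nu>\<^sub>3 p \<and> 0 < \<nu>\<^sub>4 p \<and> 0 < \<nu>\<^sub>5 p \<and>
     0 < \<sigma>_low p \<and> \<sigma>_low p < \<sigma>_up p"

text \<open>\<open>C k\<close> is the \<open>k\<close>-th polyhedron, \<open>m\<close> the model at \<open>x\<close>, and \<open>\<Delta>\<close> the trust region radius.\<close>

definition cauchy_point ::
    "trap_params \<Rightarrow> nat \<Rightarrow> ('n::finite \<Rightarrow> nat) \<Rightarrow> (nat \<Rightarrow> (real ^ 'n) set) \<Rightarrow> (real ^ 'n \<Rightarrow> real)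
      \<Rightarrow> real ^ 'n \<Rightarrow> real \<Rightarrow> real ^ 'n \<Rightarrow> bool" where
  "cauchy_point p K blk C m x \<Delta> z \<longleftrightarrow>
     (\<forall>k\<in>{1..K}.
        let xk = block blk k x;
            mk = block_model blk k m z x;
            gk = gradient mk xk;
            zk = (\<lambda>\<alpha>. closest_point (C k) (xk - \<alpha> *\<^sub>R gk))
        in \<exists>\<alpha>>0.
             block blk k z = zk \<alpha> \<and>
             mk (zk \<alpha>) \<le> mk xk + \<nu>\<^sub>0 p * (gk \<bullet> (zk \<alpha> - xk)) \<and>
             infnorm (zk \<alpha> - xk) \<le> \<nu>\<^sub>2 p * \<Delta> \<and>
             (\<alpha> \<in> {\<nu>\<^sub>4 p..\<nu>\<^sub>5 p} \<or>
              (\<exists>\<beta>>0. \<alpha> \<in> {\<nu>\<^sub>3 p * \<beta>..\<nu>\<^sub>5 p} \<and>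
                 (mk (zk \<beta>) > mk xk + \<nu>\<^sub>0 p * (gk \<bullet> (zk \<beta> - xk)) \<or>
                  infnorm (zk \<beta> - xk) \<ge> \<nu>\<^sub>1 p * \<Delta>))))"

text \<open>
  The last conjunct is what monotonicity of the inner method, started at \<open>z\<close> on the regularised
  objective, guarantees; nothing else about that method is used.
\<close>

definition refinement ::
    "trap_params \<Rightarrow> nat \<Rightarrow> ('n::finite \<Rightarrow> nat) \<Rightarrow> (nat \<Rightarrow> nat) \<Rightarrow> (nat \<Rightarrow> nat \<Rightarrow> real ^ 'n)
      \<Rightarrow> (nat \<Rightarrow> nat \<Rightarrow> real) \<Rightarrow> (real ^ 'n \<Rightarrow> real)
      \<Rightarrow> real ^ 'n \<Rightarrow> real \<Rightarrow> real ^ 'n \<Rightarrow> real ^ 'n \<Rightarrow> bool" where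
  "refinement p K blk nc \<omega> h m x \<Delta> z y \<longleftrightarrow>
     y \<in> feasible_set K blk nc \<omega> h \<and>
     m x - m y \<ge> \<gamma>\<^sub>1 p * (m x - m z) \<and>
     infnorm (y - x) \<le> \<gamma>\<^sub>2 p * \<Delta> \<and>
     (\<forall>k\<in>{1..K}. active_set nc \<omega> h k (block blk k z) \<subseteq> active_set nc \<omega> h k (block blk k y)) \<and>
     (\<exists>\<sigma>. \<sigma>_low p < \<sigma> \<and> \<sigma> < \<sigma>_up p \<and> m y + \<sigma> / 2 * (norm (y - z))\<^sup>2 \<le> m z)"

definition trap_update ::
    "trap_params \<Rightarrow> ('a \<Rightarrow> real) \<Rightarrow> ('a \<Rightarrow> real) \<Rightarrow> 'a \<Rightarrow> real \<Rightarrow> 'a \<Rightarrow> 'a \<Rightarrow> real \<Rightarrow> bool" where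
  "trap_update p L m x \<Delta> y x' \<Delta>' \<longleftrightarrow>
     (let \<rho> = (L x - L y) / (m x - m y) in
        (\<rho> < \<eta>\<^sub>1 p \<longrightarrow> x' = x \<and> \<Delta>' \<in> {\<sigma>\<^sub>1 p * \<Delta>..\<sigma>\<^sub>2 p * \<Delta>}) \<and>
        (\<rho> \<in> {\<eta>\<^sub>1 p..\<eta>\<^sub>2 p} \<longrightarrow> x' = y \<and> \<Delta>' \<in> {\<sigma>\<^sub>1 p * \<Delta>..\<sigma>\<^sub>3 p * \<Delta>}) \<and>
        (\<rho> > \<eta>\<^sub>2 p \<longrightarrow> x' = y \<and> \<Delta>' \<in> {\<Delta>..\<sigma>\<^sub>3 p * \<Delta>}))"

text \<open>Iterates \<open>x\<close>, refined points \<open>y\<close>, Cauchy points \<open>z\<close> and radii \<open>\<Delta>\<close> of an infinite run.\<close>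

definition trap_run ::
    "trap_params \<Rightarrow> nat \<Rightarrow> ('n::finite \<Rightarrow> nat) \<Rightarrow> (nat \<Rightarrow> nat) \<Rightarrow> (nat \<Rightarrow> nat \<Rightarrow> real ^ 'n)
      \<Rightarrow> (nat \<Rightarrow> nat \<Rightarrow> real) \<Rightarrow> (real ^ 'n \<Rightarrow> real) \<Rightarrow> (real ^ 'n \<Rightarrow> real ^ 'n ^ 'n)
      \<Rightarrow> (nat \<Rightarrow> real ^ 'n) \<Rightarrow> (nat \<Rightarrow> real ^ 'n) \<Rightarrow> (nat \<Rightarrow> real ^ 'n) \<Rightarrow> (nat \<Rightarrow> real) \<Rightarrow> bool" where
  "trap_run p K blk nc \<omega> h L B x y z \<Delta> \<longleftrightarrow>
     x 0 \<in> feasible_set K blk nc \<omega> h \<and> \<Delta> 0 > 0 \<and>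
     (\<forall>l. let m = model L B (x l) in
        cauchy_point p K blk (block_polyhedron blk nc \<omega> h) m (x l) (\<Delta> l) (z l) \<and>
        refinement p K blk nc \<omega> h m (x l) (\<Delta> l) (z l) (y l) \<and>
        trap_update p L m (x l) (\<Delta> l) (y l) (x (Suc l)) (\<Delta> (Suc l)))"

end

theory Submission
  imports Defs
begin

text \<open>
  If \<open>\<alpha>\<^sub>k\<close> is the step size of block \<open>k\<close>, then \<open>(x\<^sub>k - z\<^sub>k) / \<alpha>\<^sub>k - \<nabla>m\<^sub>k(x\<^sub>k)\<close> lies in the normal
  cone of \<open>\<Omega>\<^sub>k\<close> at \<open>z\<^sub>k\<close>.  The projected gradient at \<open>z\<close> is therefore bounded by the quotients
  \<open>\<parallel>z\<^sub>k - x\<^sub>k\<parallel> / \<alpha>\<^sub>k\<close> up to a term that vanishes with \<open>\<parallel>z - x\<parallel>\<close>, while the Cauchy decrease is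
  at least \<open>\<nu>\<^sub>0 \<parallel>z\<^sub>k - x\<^sub>k\<parallel>\<^sup>2 / \<alpha>\<^sub>k\<close>.  As the search conditions keep \<open>\<alpha>\<^sub>k\<close> or \<open>\<parallel>z\<^sub>k - x\<^sub>k\<parallel> / \<Delta>\<close>
  away from 0, a Cauchy point that is far from \<open>x\<close> or has a large projected gradient yields a
  decrease of order \<open>min 1 \<Delta>\<close>.

  Suppose that the projected gradient is bounded away from 0 at all late Cauchy points near the
  limit point.  The steps near the limit point are then paid for by the decrease of \<open>L\<close>, so the
  iterates are trapped there and the radii are summable.  But small radii make the ratio of actual
  to predicted decrease tend to 1, so the radii do not shrink any more: a contradiction.
  Criticality of the limit point follows by passing to the limit in the variational inequality
  satisfied at the Cauchy points.
\<close>

section \<open>Gradients and projected gradients\<close>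

lemma gradient_eq:
  assumes "GDERIV f x :> D"
  shows "gradient f x = D"
  unfolding gradient_def
proof (rule the_equality)
  fix D' assume "GDERIV f x :> D'"
  with assms have eq: "(\<lambda>h. h \<bullet> D') = (\<lambda>h. h \<bullet> D)"
    unfolding gderiv_def by (rule has_derivative_unique[rotated])
  show "D' = D"
    by (rule vector_eq_ldot[THEN iffD1]) (intro allI fun_cong[OF eq])
qed (fact assms)

lemma GDERIV_gradient:
  fixes f :: "'a::euclidean_space \<Rightarrow> real"
  assumes "f differentiable at x"
  shows "GDERIV f x :> gradient f x"
proof -
  obtain f' where f': "(f has_derivative f') (at x)"
    using assms by (auto simp: differentiable_def)
  then interpret f': bounded_linear f' by (rule has_derivative_bounded_linear)
  have "f' = (\<lambda>h. h \<bullet> adjoint f' 1)"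
    using adjoint_works[OF f'.linear_axioms, of _ 1] by (auto simp: fun_eq_iff)
  with f' have "GDERIV f x :> adjoint f' 1"
    by (simp add: gderiv_def)
  then show ?thesis
    using gradient_eq by metis
qed

text \<open>Mean value inequality for \<open>f\<close> minus its linearisation at \<open>x\<close>,
  whose gradient at \<open>v\<close> is \<open>gradient f v - gradient f x\<close>. Only the
  oscillation of the gradient along the segment enters, and uniform continuity can make it
  small.\<close>

lemma gradient_descent_error:
  fixes f :: "'a::euclidean_space \<Rightarrow> real"
  assumes "convex S" "x \<in> S" "y \<in> S" "\<And>v. v \<in> S \<Longrightarrow> f differentiable at v"
    and e: "\<And>v. v \<in> closed_segment x y \<Longrightarrow> norm (gradient f v - gradient f x) \<le> e"
  shows "\<bar>f y - f x - gradient f x \<bullet> (y - x)\<bar> \<le> e * norm (y - x)"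
proof -
  have sub: "closed_segment x y \<subseteq> S"
    using assms(1-3) by (simp add: closed_segment_subset)
  have "norm (f y - f x - (y - x) \<bullet> gradient f x) \<le> norm (y - x) * e"
  proof (rule differentiable_bound_linearization[where S = "closed_segment x y" and ?x0.0 = x
        and f' = "\<lambda>v h. h \<bullet> gradient f v"])
    fix t :: real assume "t \<in> {0..1}"
    then show "x + t *\<^sub>R (y - x) \<in> closed_segment x y"
      by (auto simp: in_segment algebra_simps intro!: exI[of _ t])
  next
    fix v assume v: "v \<in> closed_segment x y"
    then show "(f has_derivative (\<lambda>h. h \<bullet> gradient f v)) (at v within closed_segment x y)"
      using GDERIV_gradient[OF assms(4), of v] sub
      by (auto simp: gderiv_def intro: has_derivative_at_withinI)
    have "norm (h \<bullet> (gradient f v - gradient f x)) \<le> e * norm h" for h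
      using Cauchy_Schwarz_ineq2[of h "gradient f v - gradient f x"]
        mult_left_mono[OF e[OF v] norm_ge_zero[of h]]
      by (simp add: mult.commute)
    then show "onorm ((\<lambda>h. h \<bullet> gradient f v) - (\<lambda>h. h \<bullet> gradient f x)) \<le> e"
      by (intro onorm_le) (simp add: inner_diff_right fun_diff_def)
  qed simp
  then show ?thesis
    by (simp add: inner_commute mult.commute)
qed

section \<open>Tangent cones, projections onto cones, and criticality\<close>

lemma tangent_cone_properties:
  assumes "convex S" "x \<in> S"
  shows "closed (tangent_cone S x)" "convex (tangent_cone S x)" "cone (tangent_cone S x)"
    "0 \<in> tangent_cone S x" "\<And>w. w \<in> S \<Longrightarrow> w - x \<in> tangent_cone S x"
proof -
  have "convex ((\<lambda>y. y - x) ` S)"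
    using assms(1) by (simp add: convex_translation_subtract_eq)
  then show "convex (tangent_cone S x)"
    unfolding tangent_cone_def by (intro convex_closure convex_cone_hull)
  show "closed (tangent_cone S x)" by (simp add: tangent_cone_def)
  show "cone (tangent_cone S x)"
    unfolding tangent_cone_def by (intro cone_closure cone_cone_hull)
  show *: "w - x \<in> tangent_cone S x" if "w \<in> S" for w
    unfolding tangent_cone_def using that
    by (intro subsetD[OF closure_subset] hull_inc) auto
  show "0 \<in> tangent_cone S x"
    using *[OF assms(2)] by simp
qed

text \<open>A half-space bounded by a hyperplane through 0 is a closed cone, so it contains the
  closed cone generated by any of its subsets. Hence normals to \<open>S\<close> at \<open>x\<close>
  lie in the polar of the tangent cone.\<close>

lemma inner_tangent_cone_nonpos:
  fixes a :: "'a::real_inner"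
  assumes "\<And>w. w \<in> S \<Longrightarrow> a \<bullet> (w - x) \<le> 0" and "v \<in> tangent_cone S x"
  shows "a \<bullet> v \<le> 0"
proof -
  have "cone hull ((\<lambda>y. y - x) ` S) \<subseteq> {v. a \<bullet> v \<le> 0}"
    by (rule hull_minimal)
      (use assms(1) in \<open>auto simp: cone_def mult_nonneg_nonpos\<close>)
  then have "tangent_cone S x \<subseteq> {v. a \<bullet> v \<le> 0}"
    unfolding tangent_cone_def by (rule closure_minimal) (rule closed_halfspace_le)
  with assms(2) show ?thesis by auto
qed

context
  fixes T :: "'a::euclidean_space set" and q :: 'a
  assumes T: "closed T" "convex T" "cone T" "0 \<in> T"
begin

lemma closest_point_cone_mem: "closest_point T q \<in> T"
  using T by (intro closest_point_in_set) auto

text \<open>First half of Moreau's decomposition: the variational inequality of the projection,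
  tested at 0 and at twice the projection, makes the residual orthogonal to the projection.\<close>

lemma closest_point_cone_inner: "q \<bullet> closest_point T q = (norm (closest_point T q))\<^sup>2"
proof -
  let ?p = "closest_point T q"
  have "2 *\<^sub>R ?p \<in> T"
    using T(3) closest_point_cone_mem by (auto simp: cone_def)
  from closest_point_dot[OF T(2,1) this, of q] closest_point_dot[OF T(2,1,4), of q]
  have "(q - ?p) \<bullet> ?p = 0"
    by (simp add: scaleR_2)
  then show ?thesis
    by (simp add: inner_diff_left power2_norm_eq_inner)
qed

text \<open>Second half of Moreau's decomposition: the residual lies in the polar cone of
  \<open>T\<close>.\<close>

lemma inner_le_closest_point_cone:
  assumes "v \<in> T"
  shows "q \<bullet> v \<le> closest_point T q \<bullet> v"
  using closest_point_dot[OF T(2,1) assms, of q] closest_point_cone_inner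
  by (simp add: inner_diff_left inner_diff_right power2_norm_eq_inner)

end

text \<open>The norm of the projected gradient is the distance of \<open>- gradient L x\<close> from
  the normal cone, so every explicit normal vector \<open>a\<close> yields an upper bound.\<close>

lemma norm_projected_gradient_le:
  fixes L :: "'a::euclidean_space \<Rightarrow> real"
  assumes "convex S" "x \<in> S" "\<And>w. w \<in> S \<Longrightarrow> a \<bullet> (w - x) \<le> 0"
  shows "norm (projected_gradient L S x) \<le> norm (- gradient L x - a)"
proof -
  let ?g = "- gradient L x" and ?p = "projected_gradient L S x"
  note T = tangent_cone_properties[OF assms(1,2)]
  have "(norm ?p)\<^sup>2 = (?g - a) \<bullet> ?p + a \<bullet> ?p"
    using closest_point_cone_inner[OF T(1-4), of ?g]
    by (simp add: projected_gradient_def inner_diff_left)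
  also have "\<dots> \<le> norm (?g - a) * norm ?p + 0"
    using closest_point_cone_mem[OF T(1-4), of ?g]
    by (intro add_mono norm_cauchy_schwarz inner_tangent_cone_nonpos[OF assms(3)])
      (auto simp: projected_gradient_def)
  finally have "norm ?p * norm ?p \<le> norm (?g - a) * norm ?p"
    by (simp add: power2_eq_square)
  then show ?thesis
    by (cases "?p = 0") (auto dest: mult_right_le_imp_le)
qed

lemma neg_gradient_inner_le_projected_gradient:
  fixes L :: "'a::euclidean_space \<Rightarrow> real"
  assumes "convex S" "x \<in> S" "w \<in> S"
  shows "- gradient L x \<bullet> (w - x) \<le> norm (projected_gradient L S x) * norm (w - x)"
proof -
  note T = tangent_cone_properties[OF assms(1,2)]
  have "- gradient L x \<bullet> (w - x) \<le> projected_gradient L S x \<bullet> (w - x)"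
    unfolding projected_gradient_def
    by (intro inner_le_closest_point_cone[OF T(1-4)] T(5) assms(3))
  also have "\<dots> \<le> norm (projected_gradient L S x) * norm (w - x)"
    by (rule norm_cauchy_schwarz)
  finally show ?thesis .
qed

text \<open>Here \<open>- gradient L x\<close> is itself a normal vector, so the distance bound
  above becomes 0.\<close>

lemma critical_pointI:
  fixes L :: "'a::euclidean_space \<Rightarrow> real"
  assumes "convex S" "x \<in> S" "\<And>w. w \<in> S \<Longrightarrow> - gradient L x \<bullet> (w - x) \<le> 0"
  shows "critical_point L S x"
  using norm_projected_gradient_le[OF assms, of L] assms(2) by (simp add: critical_point_def)

text \<open>The tangent cone may jump at \<open>zs\<close>, so the limit is not taken in the
  projected gradient itself but in the variational inequality against a fixed \<open>w\<close>,
  whose right-hand side tends to 0.\<close>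

lemma critical_point_limit:
  fixes L :: "'a::euclidean_space \<Rightarrow> real"
  assumes S: "convex S" "closed S" and z: "\<And>i::nat. z i \<in> S" "z \<longlonglongrightarrow> zs"
    and lim: "(\<lambda>i. norm (projected_gradient L S (z i))) \<longlonglongrightarrow> 0"
    and cont: "continuous_on S (gradient L)"
  shows "critical_point L S zs"
proof (rule critical_pointI[OF S(1)])
  show zs: "zs \<in> S"
    using closed_sequentially[OF S(2)] z by blast
  have g: "(\<lambda>i. gradient L (z i)) \<longlonglongrightarrow> gradient L zs"
    using continuous_on_tendsto_compose[OF cont z(2) zs] z(1) by auto
  fix w assume w: "w \<in> S"
  have "(\<lambda>i. - gradient L (z i) \<bullet> (w - z i)) \<longlonglongrightarrow> - gradient L zs \<bullet> (w - zs)"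
    by (intro tendsto_intros g z(2))
  moreover have "(\<lambda>i. norm (projected_gradient L S (z i)) * norm (w - z i)) \<longlonglongrightarrow> 0 * norm (w - zs)"
    by (intro tendsto_intros lim z(2))
  ultimately show "- gradient L zs \<bullet> (w - zs) \<le> 0"
    using neg_gradient_inner_le_projected_gradient[OF S(1) z(1) w, of L]
    by (intro LIMSEQ_le[of _ _ _ 0]) auto
qed

section \<open>Projection arcs\<close>

text \<open>Along the projection arc the displacement grows with the step size, while its quotient
  by the step size shrinks. Both facts come from one product inequality, \<open>prod\<close>,
  obtained from the two variational inequalities.\<close>

lemma projection_arc_monotone:
  fixes x g :: "'a::euclidean_space"
  assumes C: "convex C" "closed C" "x \<in> C" and ab: "0 < \<alpha>" "\<alpha> \<le> \<beta>"
  defines "d \<equiv> \<lambda>t. closest_point C (x - t *\<^sub>R g) - x"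
  shows "norm (d \<alpha>) \<le> norm (d \<beta>)" "\<alpha> * norm (d \<beta>) \<le> \<beta> * norm (d \<alpha>)"
proof -
  let ?a = "d \<alpha>" and ?b = "d \<beta>"
  have mem: "closest_point C u \<in> C" for u
    using C by (intro closest_point_in_set) auto
  have "(x - \<alpha> *\<^sub>R g - closest_point C (x - \<alpha> *\<^sub>R g)) \<bullet>
      (closest_point C (x - \<beta> *\<^sub>R g) - closest_point C (x - \<alpha> *\<^sub>R g)) \<le> 0"
    by (rule closest_point_dot[OF C(1,2) mem])
  then have 1: "(- \<alpha> *\<^sub>R g - ?a) \<bullet> (?b - ?a) \<le> 0"
    by (simp add: d_def algebra_simps)
  have "(x - \<beta> *\<^sub>R g - closest_point C (x - \<beta> *\<^sub>R g)) \<bullet>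
      (closest_point C (x - \<alpha> *\<^sub>R g) - closest_point C (x - \<beta> *\<^sub>R g)) \<le> 0"
    by (rule closest_point_dot[OF C(1,2) mem])
  then have 2: "(- \<beta> *\<^sub>R g - ?b) \<bullet> (?a - ?b) \<le> 0"
    by (simp add: d_def algebra_simps)
  \<comment> \<open>The weights \<beta> and \<alpha> make the terms containing \<open>g\<close>
    cancel.\<close>
  have "\<beta> * ((- \<alpha> *\<^sub>R g - ?a) \<bullet> (?b - ?a)) + \<alpha> * ((- \<beta> *\<^sub>R g - ?b) \<bullet> (?a - ?b)) \<le> 0"
    using 1 2 ab by (intro add_nonpos_nonpos mult_nonneg_nonpos) auto
  then have "\<beta> * (?a \<bullet> ?a) + \<alpha> * (?b \<bullet> ?b) \<le> (\<alpha> + \<beta>) * (?a \<bullet> ?b)"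
    by (simp add: inner_diff_left inner_diff_right inner_commute algebra_simps)
  also have "\<dots> \<le> (\<alpha> + \<beta>) * (norm ?a * norm ?b)"
    using ab by (intro mult_left_mono norm_cauchy_schwarz) auto
  finally have prod: "0 \<le> (norm ?b - norm ?a) * (\<beta> * norm ?a - \<alpha> * norm ?b)"
    by (simp add: dot_square_norm power2_eq_square algebra_simps)
  \<comment> \<open>Otherwise the first factor in \<open>prod\<close> is negative, and
    \<open>\<alpha> * norm ?b \<le> \<beta> * norm ?b < \<beta> * norm ?a\<close> makes the second
    one positive.\<close>
  show le: "norm ?a \<le> norm ?b"
  proof (rule ccontr)
    assume "\<not> norm ?a \<le> norm ?b"
    then have "norm ?b < norm ?a" by simp
    moreover have "\<alpha> * norm ?b \<le> \<beta> * norm ?b"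
      using ab by (intro mult_right_mono) auto
    moreover have "\<beta> * norm ?b < \<beta> * norm ?a"
      using ab calculation(1) by simp
    ultimately have "(norm ?b - norm ?a) * (\<beta> * norm ?a - \<alpha> * norm ?b) < 0"
      by (intro mult_neg_pos) auto
    with prod show False by simp
  qed
  show "\<alpha> * norm ?b \<le> \<beta> * norm ?a"
  proof (cases "norm ?a = norm ?b")
    case True
    then show ?thesis using ab by (metis mult_right_mono norm_ge_zero)
  next
    case False
    with le prod show ?thesis by (auto simp: zero_le_mult_iff)
  qed
qed

text \<open>If \<beta> is at most \<alpha>, monotonicity of the length suffices; otherwise
  monotonicity of the quotient loses at most the factor \<alpha>/\<beta>, which is at least
  \<open>c\<close>.\<close>

lemma projection_arc_scaled:
  fixes x g :: "'a::euclidean_space"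
  assumes C: "convex C" "closed C" "x \<in> C" and "0 < c" "0 < \<beta>" "c * \<beta> \<le> \<alpha>"
  defines "d \<equiv> \<lambda>t. closest_point C (x - t *\<^sub>R g) - x"
  shows "min 1 c * norm (d \<beta>) \<le> norm (d \<alpha>)"
proof (cases "\<beta> \<le> \<alpha>")
  case True
  then have "norm (d \<beta>) \<le> norm (d \<alpha>)"
    unfolding d_def using projection_arc_monotone(1)[OF C] assms by blast
  moreover have "min 1 c * norm (d \<beta>) \<le> 1 * norm (d \<beta>)"
    by (intro mult_right_mono) auto
  ultimately show ?thesis by simp
next
  case False
  moreover have "0 < c * \<beta>" using assms by simp
  ultimately have "0 < \<alpha>" "\<alpha> \<le> \<beta>" using assms(6) by linarith+
  then have "\<alpha> * norm (d \<beta>) \<le> \<beta> * norm (d \<alpha>)"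
    unfolding d_def using projection_arc_monotone(2)[OF C] by blast
  moreover have "\<beta> * (min 1 c * norm (d \<beta>)) \<le> \<alpha> * norm (d \<beta>)"
  proof -
    have "\<beta> * min 1 c \<le> \<beta> * c" using assms by simp
    also have "\<dots> \<le> \<alpha>" using assms by (simp add: mult.commute)
    finally show ?thesis
      by (metis mult.assoc mult_right_mono norm_ge_zero)
  qed
  ultimately show ?thesis
    using assms(5) by (metis mult_left_le_imp_le order_trans)
qed

text \<open>
  Failure of the Armijo condition at \<open>\<beta>\<close> forces \<open>\<beta>\<close> to be large, because the projection
  step satisfies \<open>\<parallel>d\<parallel>\<^sup>2 \<le> - \<beta> (G \<bullet> d)\<close>; a long step at \<open>\<beta>\<close> is inherited by \<open>\<alpha>\<close>.
\<close>

lemma projected_search_step: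
  fixes q :: "'a::euclidean_space \<Rightarrow> real" and u G :: 'a
  assumes C: "convex C" "closed C" "u \<in> C"
    and b: "0 < b" "\<And>v. v \<in> C \<Longrightarrow> q v \<le> q u + G \<bullet> (v - u) + b / 2 * (norm (v - u))\<^sup>2"
    and c: "0 < c0" "c0 < 1" "0 < c3"
  defines "zk \<equiv> \<lambda>t. closest_point C (u - t *\<^sub>R G)"
  assumes \<alpha>: "0 < \<alpha>" "q (zk \<alpha>) \<le> q u + c0 * (G \<bullet> (zk \<alpha> - u))"
    and search: "c4 \<le> \<alpha> \<or> (\<exists>\<beta>>0. c3 * \<beta> \<le> \<alpha> \<and>
        (q (zk \<beta>) > q u + c0 * (G \<bullet> (zk \<beta> - u)) \<or> r \<le> norm (zk \<beta> - u)))"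
  shows "c0 * ((norm (zk \<alpha> - u))\<^sup>2 / \<alpha>) \<le> q u - q (zk \<alpha>)"
    and "min c4 (2 * c3 * (1 - c0) / b) \<le> \<alpha> \<or> min 1 c3 * r \<le> norm (zk \<alpha> - u)"
proof -
  have mem: "zk t \<in> C" for t
    unfolding zk_def using C by (intro closest_point_in_set) auto
  have desc: "(norm (zk t - u))\<^sup>2 \<le> - t * (G \<bullet> (zk t - u))" for t
    using closest_point_dot[OF C, of "u - t *\<^sub>R G"]
    by (simp add: zk_def inner_diff_left inner_diff_right inner_commute power2_norm_eq_inner
        algebra_simps)
  have "(norm (zk \<alpha> - u))\<^sup>2 / \<alpha> \<le> - (G \<bullet> (zk \<alpha> - u))"
    using desc[of \<alpha>] \<alpha>(1) by (simp add: field_simps)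
  then have "c0 * ((norm (zk \<alpha> - u))\<^sup>2 / \<alpha>) \<le> c0 * - (G \<bullet> (zk \<alpha> - u))"
    using c by (intro mult_left_mono) auto
  with \<alpha>(2) show "c0 * ((norm (zk \<alpha> - u))\<^sup>2 / \<alpha>) \<le> q u - q (zk \<alpha>)"
    by simp
  show "min c4 (2 * c3 * (1 - c0) / b) \<le> \<alpha> \<or> min 1 c3 * r \<le> norm (zk \<alpha> - u)"
    using search
  proof (elim disjE exE conjE)
    fix \<beta> assume \<beta>: "0 < \<beta>" "c3 * \<beta> \<le> \<alpha>" and fail: "q u + c0 * (G \<bullet> (zk \<beta> - u)) < q (zk \<beta>)"
    define n where "n = (norm (zk \<beta> - u))\<^sup>2"
    define s where "s = - (G \<bullet> (zk \<beta> - u))"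
    have "n \<le> \<beta> * s" using desc[of \<beta>] by (simp add: n_def s_def)
    have less: "(1 - c0) * s < b / 2 * n"
      using fail b(2)[OF mem[of \<beta>]] by (simp add: n_def s_def algebra_simps)
    have "n \<ge> 0" by (simp add: n_def)
    have "(1 - c0) * n \<le> (1 - c0) * (\<beta> * s)"
      using \<open>n \<le> \<beta> * s\<close> c by (intro mult_left_mono) auto
    also have "\<dots> = \<beta> * ((1 - c0) * s)" by simp
    also have "\<dots> < \<beta> * (b / 2 * n)" using less \<beta>(1) by simp
    finally have *: "(1 - c0) * n < \<beta> * b / 2 * n" by simp
    \<comment> \<open>The strict inequality excludes a zero projection step, so \<open>n\<close> may
      be cancelled.\<close>
    then have "n \<noteq> 0" by auto
    with \<open>n \<ge> 0\<close> have "n > 0" by simp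
    with * have "1 - c0 < \<beta> * b / 2" by simp
    then have "2 * (1 - c0) / b \<le> \<beta>"
      using b(1) by (simp add: field_simps)
    then have "c3 * (2 * (1 - c0) / b) \<le> c3 * \<beta>"
      using c by (intro mult_left_mono) auto
    then have "2 * c3 * (1 - c0) / b \<le> c3 * \<beta>"
      by (simp add: mult.commute mult.left_commute)
    with \<beta>(2) show ?thesis by linarith
  next
    fix \<beta> assume \<beta>: "0 < \<beta>" "c3 * \<beta> \<le> \<alpha>" and long: "r \<le> norm (zk \<beta> - u)"
    have "min 1 c3 * norm (zk \<beta> - u) \<le> norm (zk \<alpha> - u)"
      unfolding zk_def using projection_arc_scaled[OF C c(3) \<beta>] .
    moreover have "min 1 c3 * r \<le> min 1 c3 * norm (zk \<beta> - u)"
      using long c by (intro mult_left_mono) auto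
    ultimately show ?thesis by linarith
  qed auto
qed

section \<open>Shrinking radii\<close>

text \<open>
  Near \<open>xs\<close> the radius of a successful step is controlled by the decrease of \<open>f\<close>; hence the
  path that the iterates still have to travel is bounded by the decrease that is left, and the
  sequence can no longer leave a ball around \<open>xs\<close> once it has come close enough to the centre.
\<close>

lemma trust_region_trapped:
  fixes x :: "nat \<Rightarrow> 'a::real_normed_vector" and f r :: "nat \<Rightarrow> real"
  assumes r: "\<And>l. 0 < r l"
    and s: "0 < s2" "s2 < 1" "0 < s3" and pos: "0 < c" "0 < \<kappa>" "0 < \<epsilon>"
    and f: "decseq f" "\<And>l. f0 \<le> f l"
    and update: "\<And>l. x (Suc l) = x l \<and> r (Suc l) \<le> s2 * r l \<or>
        norm (x (Suc l) - x l) \<le> c * r l \<and> r (Suc l) \<le> s3 * r l \<and>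
        (N \<le> l \<longrightarrow> dist (x l) xs < \<epsilon> \<longrightarrow> \<kappa> * min 1 (r l) \<le> f l - f (Suc l))"
    and lim: "strict_mono \<phi>" "(\<lambda>i. x (\<phi> i)) \<longlonglongrightarrow> xs"
  shows "r \<longlonglongrightarrow> 0" "\<forall>\<^sub>F l in sequentially. dist (x l) xs < \<epsilon>"
proof -
  obtain F where F: "f \<longlonglongrightarrow> F" "\<And>l. F \<le> f l"
    using decseq_convergent[OF f(1), of f0] f(2) by blast
  define C where "C = c / \<kappa>"
  have "C > 0" using pos by (simp add: C_def)
  \<comment> \<open>\<open>C\<close> is the path length per unit of decrease. A remaining decrease
    below \<kappa> forces \<open>min 1 (r l) = r l\<close>; one below
    \<open>\<epsilon> / (2 * C)\<close> keeps the remaining path shorter than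
    \<open>\<epsilon> / 2\<close>.\<close>
  define \<delta> where "\<delta> = min \<kappa> (\<epsilon> / (2 * C))"
  have "\<delta> > 0" using pos \<open>C > 0\<close> by (simp add: \<delta>_def)
  have "\<forall>\<^sub>F i in sequentially. f i < F + \<delta>"
    using F(1) \<open>\<delta> > 0\<close> by (intro order_tendstoD(2)) auto
  then obtain N1 where N1: "\<And>l. l \<ge> N1 \<Longrightarrow> f l < F + \<delta>"
    by (auto simp: eventually_sequentially)
  have "\<forall>\<^sub>F i in sequentially. dist (x (\<phi> i)) xs < \<epsilon> / 2"
    using tendstoD[OF lim(2)] pos(3) by (meson half_gt_zero)
  then obtain i where i: "i \<ge> max N N1" "dist (x (\<phi> i)) xs < \<epsilon> / 2"
    by (metis (no_types, lifting) eventually_sequentially nle_le)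
  define l0 where "l0 = \<phi> i"
  have l0: "l0 \<ge> N" "l0 \<ge> N1" "dist (x l0) xs < \<epsilon> / 2"
    using i seq_suble[OF lim(1), of i] by (auto simp: l0_def)
  have drop: "r l \<le> (f l - f (Suc l)) / \<kappa>"
    if l: "l \<ge> l0" and d: "\<kappa> * min 1 (r l) \<le> f l - f (Suc l)" for l
  proof -
    have "f l - f (Suc l) < \<kappa>"
      using N1[of l] F(2)[of "Suc l"] l l0 unfolding \<delta>_def by linarith
    with d have "\<kappa> * min 1 (r l) < \<kappa> * 1" by simp
    then have "min 1 (r l) < 1" using pos by (simp only: mult_less_cancel_left_pos)
    then have "min 1 (r l) = r l" by auto
    with d show ?thesis using pos by (simp add: field_simps)
  qed
  have near: "dist (x l) xs < \<epsilon>"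
    if "l \<ge> l0" "dist (x l0) (x l) \<le> C * (f l0 - f l)" for l
  proof -
    have "f l0 - f l < \<epsilon> / (2 * C)"
      using N1[of l0] F(2)[of l] l0 unfolding \<delta>_def by linarith
    then have "C * (f l0 - f l) < \<epsilon> / 2"
      using \<open>C > 0\<close> by (simp add: field_simps)
    then show ?thesis
      using that(2) l0(3) dist_triangle3[of "x l" xs "x l0"] by (simp add: dist_commute)
  qed
  \<comment> \<open>By \<open>near\<close>, the induction hypothesis places \<open>x l\<close> in
    the ball, which activates the decrease clause of \<open>update\<close> for the next
    step.\<close>
  have path: "dist (x l0) (x l) \<le> C * (f l0 - f l)" if "l \<ge> l0" for l
    using that
  proof (induction l rule: dec_induct)
    case (step l)
    have "dist (x l) (x (Suc l)) \<le> C * (f l - f (Suc l))"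
    proof (cases "x (Suc l) = x l")
      case True
      then show ?thesis using f(1) \<open>C > 0\<close> by (simp add: decseq_Suc_iff)
    next
      case False
      then have st: "norm (x (Suc l) - x l) \<le> c * r l" "\<kappa> * min 1 (r l) \<le> f l - f (Suc l)"
        using update[of l] near[OF _ step.IH] step.hyps l0 by auto
      have "c * r l \<le> c * ((f l - f (Suc l)) / \<kappa>)"
        using drop[OF _ st(2)] step.hyps pos by (intro mult_left_mono) auto
      then show ?thesis using st(1) by (simp add: C_def dist_norm norm_minus_commute)
    qed
    then show ?case
      using step.IH dist_triangle[of "x l0" "x (Suc l)" "x l"] by (simp add: algebra_simps)
  qed simp
  then have close: "dist (x l) xs < \<epsilon>" if "l \<ge> l0" for l
    using near that by blast
  then show "\<forall>\<^sub>F l in sequentially. dist (x l) xs < \<epsilon>"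
    by (auto simp: eventually_sequentially)
  define D where "D = s3 / \<kappa>"
  have "D > 0" using s pos by (simp add: D_def)
  \<comment> \<open>A rejected step contracts the radius by \<open>s2\<close>; in an accepted step
    the new radius is paid for by the decrease of \<open>f\<close>. One recursion covers
    both.\<close>
  have rec: "r (Suc l) \<le> s2 * r l + D * (f l - f (Suc l))" if "l \<ge> l0" for l
    using update[of l]
  proof (elim disjE conjE)
    assume "r (Suc l) \<le> s2 * r l"
    moreover have "0 \<le> D * (f l - f (Suc l))"
      using f(1) \<open>D > 0\<close> by (simp add: decseq_Suc_iff)
    ultimately show ?thesis by linarith
  next
    assume a: "r (Suc l) \<le> s3 * r l"
      "N \<le> l \<longrightarrow> dist (x l) xs < \<epsilon> \<longrightarrow> \<kappa> * min 1 (r l) \<le> f l - f (Suc l)"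
    then have "r l \<le> (f l - f (Suc l)) / \<kappa>"
      using that l0 close by (intro drop) auto
    then have "s3 * r l \<le> s3 * ((f l - f (Suc l)) / \<kappa>)"
      using s by (intro mult_left_mono) auto
    also have "\<dots> = D * (f l - f (Suc l))" by (simp add: D_def)
    finally show ?thesis using a s r[of l] by (smt (verit) mult_pos_pos)
  qed
  \<comment> \<open>Summing \<open>rec\<close> telescopes the decreases and leaves the factor
    \<open>1 - s2\<close> in front of the sum of the radii.\<close>
  have bound: "(1 - s2) * (\<Sum>i<n. r (l0 + i)) \<le> r l0 + D * (f l0 - f (l0 + n)) - r (l0 + n)" for n
  proof (induction n)
    case (Suc n)
    then show ?case using rec[of "l0 + n"] by (simp add: algebra_simps)
  qed simp
  have "(\<Sum>i<n. r (l0 + i)) \<le> (r l0 + D * (f l0 - F)) / (1 - s2)" for n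
  proof -
    have "D * (f l0 - f (l0 + n)) \<le> D * (f l0 - F)"
      using F(2)[of "l0 + n"] \<open>D > 0\<close> by (intro mult_left_mono) auto
    then have "(1 - s2) * (\<Sum>i<n. r (l0 + i)) \<le> r l0 + D * (f l0 - F)"
      using bound[of n] r[of "l0 + n"] by linarith
    then show ?thesis using s by (simp add: field_simps)
  qed
  then have "summable (\<lambda>i. r (l0 + i))"
    using r by (intro summableI_nonneg_bounded) (auto intro: less_imp_le)
  then have "(\<lambda>i. r (i + l0)) \<longlonglongrightarrow> 0"
    by (simp add: summable_LIMSEQ_zero add.commute)
  then show "r \<longlonglongrightarrow> 0" by (rule LIMSEQ_offset)
qed

section \<open>Blocks and the quadratic model\<close>

lemma block_nth [simp]: "block blk k v $ j = (if blk j = k then v $ j else 0)"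
  by (simp add: block_def)

lemma linear_block: "linear (block blk k)"
  by (rule linearI) (auto simp: vec_eq_iff)

lemmas bounded_linear_block = linear_block[THEN linear_conv_bounded_linear[THEN iffD1]]

lemmas block_diff = linear_diff[OF linear_block] and block_add = linear_add[OF linear_block]
  and block_scale = linear_scale[OF linear_block] and block_zero = linear_0[OF linear_block]
  and block_minus = linear_neg[OF linear_block]

lemma block_space_iff: "u \<in> block_space blk k \<longleftrightarrow> block blk k u = u"
  by (auto simp: block_space_def vec_eq_iff)

lemma block_block [simp]: "block blk k (block blk k v) = block blk k v"
  by (simp add: vec_eq_iff)

lemma inner_block_left: "block blk k a \<bullet> b = a \<bullet> block blk k b"
  unfolding inner_vec_def by (intro sum.cong) auto

lemma norm_block_le: "norm (block blk k v) \<le> norm v"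
  by (rule norm_le_componentwise_cart) auto

lemma sum_block:
  assumes "\<forall>j. blk j \<in> {1..K}"
  shows "(\<Sum>k=1..K. block blk k v) = v"
proof -
  have "(\<Sum>k=1..K. block blk k v) $ j = v $ j" for j
    using assms by (simp add: sum.delta)
  then show ?thesis by (simp add: vec_eq_iff)
qed

lemma block_polyhedron_eq:
  "block_polyhedron blk nc \<omega> h k =
     {u. block blk k u = u} \<inter> (\<Inter>i\<in>{1..nc k}. {u. \<omega> k i \<bullet> u \<le> h k i})"
  by (auto simp: block_polyhedron_def block_space_iff)

lemma subspace_block_fixed: "subspace {u. block blk k u = u}"
  by (auto simp: subspace_def block_add block_scale block_zero)

lemma convex_block_polyhedron: "convex (block_polyhedron blk nc \<omega> h k)"
  unfolding block_polyhedron_eq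
  by (intro convex_Int convex_INT convex_halfspace_le subspace_imp_convex subspace_block_fixed)

lemma closed_block_polyhedron: "closed (block_polyhedron blk nc \<omega> h k)"
  unfolding block_polyhedron_eq
  by (intro closed_Int closed_INT ballI closed_halfspace_le closed_subspace subspace_block_fixed)

lemma feasible_set_eq:
  "feasible_set K blk nc \<omega> h = (\<Inter>k\<in>{1..K}. block blk k -` block_polyhedron blk nc \<omega> h k)"
  by (auto simp: feasible_set_def)

lemma convex_feasible_set: "convex (feasible_set K blk nc \<omega> h)"
  unfolding feasible_set_eq
  by (intro convex_INT convex_linear_vimage linear_block convex_block_polyhedron)

lemma closed_feasible_set: "closed (feasible_set K blk nc \<omega> h)"
  unfolding feasible_set_eq
  by (intro closed_INT ballI closed_vimage closed_block_polyhedron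
      linear_continuous_on[OF bounded_linear_block])

section \<open>Quadratic forms and expansion of the model\<close>

lemma inner_matrix_symmetric:
  fixes A :: "real ^ 'n ^ 'n"
  assumes "transpose A = A"
  shows "u \<bullet> (A *v v) = v \<bullet> (A *v u)"
proof -
  have "u \<bullet> (A *v v) = (u v* A) \<bullet> v" by (simp add: dot_lmul_matrix)
  also have "u v* A = A *v u"
    using assms by (metis transpose_matrix_vector)
  finally show ?thesis by (simp add: inner_commute)
qed

lemma norm_matrix_mult_le:
  fixes A :: "real ^ 'n ^ 'm"
  assumes "onorm ((*v) A) \<le> b"
  shows "norm (A *v v) \<le> b * norm v"
  using onorm[OF matrix_vector_mul_bounded_linear[of A], of v] mult_right_mono[OF assms norm_ge_zero[of v]]
  by linarith

lemma quadratic_form_le: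
  fixes A :: "real ^ 'n ^ 'n"
  assumes "onorm ((*v) A) \<le> b"
  shows "\<bar>v \<bullet> (A *v v)\<bar> \<le> b * (norm v)\<^sup>2"
proof -
  have "\<bar>v \<bullet> (A *v v)\<bar> \<le> norm v * norm (A *v v)" by (rule Cauchy_Schwarz_ineq2)
  also have "\<dots> \<le> norm v * (b * norm v)"
    by (intro mult_left_mono norm_matrix_mult_le assms) auto
  finally show ?thesis by (simp add: power2_eq_square mult_ac)
qed

text \<open>Taylor expansion, exact for a quadratic; symmetry of \<open>B x\<close> merges the two
  cross terms.\<close>

lemma model_add:
  assumes "transpose (B x) = B x"
  shows "model L B x (w + d) =
    model L B x w + (gradient L x + B x *v (w - x)) \<bullet> d + 1 / 2 * (d \<bullet> (B x *v d))"
proof -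
  let ?v = "w - x"
  have "w + d - x = ?v + d" by simp
  moreover have "(?v + d) \<bullet> (B x *v (?v + d)) =
      ?v \<bullet> (B x *v ?v) + 2 * ((B x *v ?v) \<bullet> d) + d \<bullet> (B x *v d)"
    using inner_matrix_symmetric[OF assms, of ?v d]
    by (simp add: matrix_vector_right_distrib inner_add_left inner_add_right inner_commute)
  ultimately show ?thesis
    by (simp add: model_def inner_add_left inner_add_right algebra_simps)
qed

section \<open>The alternating sweep over the blocks\<close>

text \<open>The point from which the sweep treats block \<open>k\<close>. It is \<open>x\<close> at
  index 1 and \<open>z\<close> at \<open>Suc K\<close>, so the decreases of the stages
  telescope.\<close>

definition alternating_point :: "('n::finite \<Rightarrow> nat) \<Rightarrow> nat \<Rightarrow> real ^ 'n \<Rightarrow> real ^ 'n \<Rightarrow> real ^ 'n" where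
  "alternating_point blk k z x = (\<chi> j. if blk j < k then z $ j else x $ j)"

lemma alternating_point_first:
  assumes "\<forall>j. blk j \<in> {1..K}"
  shows "alternating_point blk 1 z x = x"
proof -
  have "blk j \<noteq> 0" for j using spec[OF assms, of j] by auto
  then have "(blk j < 1) = False" for j by (meson less_one)
  then show ?thesis
    by (simp only: alternating_point_def vec_eq_iff vec_lambda_beta if_False simp_thms)
qed

lemma alternating_point_last: "\<forall>j. blk j \<in> {1..K} \<Longrightarrow> alternating_point blk (Suc K) z x = z"
  by (simp add: alternating_point_def vec_eq_iff less_Suc_eq_le)

lemma norm_alternating_point_diff_le: "norm (alternating_point blk k z x - x) \<le> norm (z - x)"
  by (rule norm_le_componentwise_cart) (auto simp: alternating_point_def)

lemma block_model_eq:
  "block_model blk k m z x u = m (alternating_point blk k z x + block blk k (u - x))"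
  unfolding block_model_def
  by (rule arg_cong[of _ _ m]) (auto simp: alternating_point_def vec_eq_iff)

lemma block_model_start: "block_model blk k m z x (block blk k x) = m (alternating_point blk k z x)"
  by (simp add: block_model_eq block_diff)

lemma block_model_end:
  "block_model blk k m z x (block blk k z) = m (alternating_point blk (Suc k) z x)"
  unfolding block_model_def
  by (rule arg_cong[of _ _ m]) (auto simp: alternating_point_def vec_eq_iff less_Suc_eq)

text \<open>Closed form of the gradient of the block model at the current block, as
  \<open>gradient_block_model\<close> shows: block \<open>k\<close> of the model's gradient at the
  alternating point.\<close>

definition stage_gradient ::
    "('n::finite \<Rightarrow> nat) \<Rightarrow> nat \<Rightarrow> (real ^ 'n \<Rightarrow> real) \<Rightarrow> (real ^ 'n \<Rightarrow> real ^ 'n ^ 'n)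
      \<Rightarrow> real ^ 'n \<Rightarrow> real ^ 'n \<Rightarrow> real ^ 'n" where
  "stage_gradient blk k L B z x =
     block blk k (gradient L x + B x *v (alternating_point blk k z x - x))"

lemma block_model_expansion:
  assumes "transpose (B x) = B x"
  shows "block_model blk k (model L B x) z x u =
    block_model blk k (model L B x) z x (block blk k x) + stage_gradient blk k L B z x \<bullet> (u - block blk k x)
      + 1 / 2 * (block blk k (u - x) \<bullet> (B x *v block blk k (u - x)))"
  unfolding block_model_start
  unfolding block_model_eq model_add[of B x, OF assms]
  by (simp add: stage_gradient_def inner_block_left block_diff)

lemma gradient_block_model:
  assumes "transpose (B x) = B x"
  shows "gradient (block_model blk k (model L B x) z x) (block blk k x) = stage_gradient blk k L B z x"
proof (rule gradient_eq)
  let ?G = "stage_gradient blk k L B z x"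
  have d: "((\<lambda>u. block blk k (u - x)) has_derivative block blk k) (at (block blk k x))"
    by (intro derivative_eq_intros bounded_linear.has_derivative[OF bounded_linear_block])
      (auto simp: block_diff)
  have eq: "block_model blk k (model L B x) z x =
      (\<lambda>u. block_model blk k (model L B x) z x (block blk k x) + ?G \<bullet> (u - block blk k x)
        + 1 / 2 * (block blk k (u - x) \<bullet> (B x *v block blk k (u - x))))"
    by (rule ext) (rule block_model_expansion[of B x, OF assms])
  \<comment> \<open>The quadratic term contributes nothing, since \<open>block blk k (u - x)\<close>
    vanishes at \<open>u = block blk k x\<close>.\<close>
  have "((\<lambda>u. c + ?G \<bullet> (u - block blk k x)
      + 1 / 2 * (block blk k (u - x) \<bullet> (B x *v block blk k (u - x)))) has_derivative (\<lambda>v. v \<bullet> ?G))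
      (at (block blk k x))" for c
    by (rule derivative_eq_intros d
        bounded_linear.has_derivative[OF matrix_vector_mul_bounded_linear] refl)+
      (simp add: fun_eq_iff block_diff inner_commute)
  then show "GDERIV (block_model blk k (model L B x) z x) (block blk k x) :> ?G"
    unfolding gderiv_def by (subst eq)
qed

text \<open>Instance of \<open>projected_search_step\<close> in which \<open>b\<close> bounds the
  curvature. The long-step alternative of the search is stated in the maximum norm and carries over
  because the Euclidean norm dominates it.\<close>

lemma cauchy_point_step:
  fixes x z :: "real ^ 'n::finite"
  assumes p: "valid_params p" and k: "k \<in> {1..K}"
    and cp: "cauchy_point p K blk C (model L B x) x r z"
    and B: "transpose (B x) = B x" "onorm ((*v) (B x)) \<le> b" "0 < b"
    and C: "convex (C k)" "closed (C k)" "C k \<subseteq> block_space blk k" "block blk k x \<in> C k"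
  obtains \<alpha> where "0 < \<alpha>" "\<alpha> \<le> \<nu>\<^sub>5 p"
    "block blk k z = closest_point (C k) (block blk k x - \<alpha> *\<^sub>R stage_gradient blk k L B z x)"
    "\<nu>\<^sub>0 p * ((norm (block blk k (z - x)))\<^sup>2 / \<alpha>) \<le>
       model L B x (alternating_point blk k z x) - model L B x (alternating_point blk (Suc k) z x)"
    "min (\<nu>\<^sub>4 p) (2 * \<nu>\<^sub>3 p * (1 - \<nu>\<^sub>0 p) / b) \<le> \<alpha> \<or>
       min 1 (\<nu>\<^sub>3 p) * (\<nu>\<^sub>1 p * r) \<le> norm (block blk k (z - x))"
proof -
  let ?u = "block blk k x" and ?q = "block_model blk k (model L B x) z x"
    and ?G = "stage_gradient blk k L B z x"
  let ?zk = "\<lambda>t. closest_point (C k) (?u - t *\<^sub>R ?G)"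
  obtain \<alpha> where \<alpha>: "0 < \<alpha>" "block blk k z = ?zk \<alpha>"
      "?q (?zk \<alpha>) \<le> ?q ?u + \<nu>\<^sub>0 p * (?G \<bullet> (?zk \<alpha> - ?u))"
      "\<alpha> \<in> {\<nu>\<^sub>4 p..\<nu>\<^sub>5 p} \<or>
        (\<exists>\<beta>>0. \<alpha> \<in> {\<nu>\<^sub>3 p * \<beta>..\<nu>\<^sub>5 p} \<and>
          (?q (?zk \<beta>) > ?q ?u + \<nu>\<^sub>0 p * (?G \<bullet> (?zk \<beta> - ?u)) \<or>
           infnorm (?zk \<beta> - ?u) \<ge> \<nu>\<^sub>1 p * r))"
    using bspec[OF cp[unfolded cauchy_point_def Let_def] k]
    unfolding gradient_block_model[of B x, OF B(1)] by blast
  have quad: "?q v \<le> ?q ?u + ?G \<bullet> (v - ?u) + b / 2 * (norm (v - ?u))\<^sup>2" if "v \<in> C k" for v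
  proof -
    have "block blk k (v - x) = v - ?u"
      using that C(3) by (auto simp: block_diff block_space_iff)
    then show ?thesis
      using quadratic_form_le[OF B(2), of "v - ?u"]
      by (subst block_model_expansion[of B x, OF B(1)]) simp
  qed
  have search: "\<nu>\<^sub>4 p \<le> \<alpha> \<or> (\<exists>\<beta>>0. \<nu>\<^sub>3 p * \<beta> \<le> \<alpha> \<and>
      (?q (?zk \<beta>) > ?q ?u + \<nu>\<^sub>0 p * (?G \<bullet> (?zk \<beta> - ?u)) \<or> \<nu>\<^sub>1 p * r \<le> norm (?zk \<beta> - ?u)))"
    using \<alpha>(4)
  proof (elim disjE exE conjE)
    fix \<beta> assume "0 < \<beta>" "\<alpha> \<in> {\<nu>\<^sub>3 p * \<beta>..\<nu>\<^sub>5 p}" "infnorm (?zk \<beta> - ?u) \<ge> \<nu>\<^sub>1 p * r"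
    then show ?thesis
      using infnorm_le_norm[of "?zk \<beta> - ?u"] by (intro disjI2 exI[of _ \<beta>]) auto
  qed auto
  have pp: "0 < \<nu>\<^sub>0 p" "\<nu>\<^sub>0 p < 1" "0 < \<nu>\<^sub>3 p"
    using p by (auto simp: valid_params_def)
  have dec: "\<nu>\<^sub>0 p * ((norm (?zk \<alpha> - ?u))\<^sup>2 / \<alpha>) \<le> ?q ?u - ?q (?zk \<alpha>)"
    by (rule projected_search_step(1)[OF C(1,2,4) B(3) quad pp \<alpha>(1,3) search])
  have long: "min (\<nu>\<^sub>4 p) (2 * \<nu>\<^sub>3 p * (1 - \<nu>\<^sub>0 p) / b) \<le> \<alpha> \<or>
      min 1 (\<nu>\<^sub>3 p) * (\<nu>\<^sub>1 p * r) \<le> norm (?zk \<alpha> - ?u)"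
    by (rule projected_search_step(2)[OF C(1,2,4) B(3) quad pp \<alpha>(1,3) search])
  show thesis
  proof (rule that[OF \<alpha>(1) _ \<alpha>(2)])
    show "\<alpha> \<le> \<nu>\<^sub>5 p" using \<alpha>(4) by auto
  qed (use dec long in \<open>simp_all only: \<alpha>(2)[symmetric] block_diff block_model_start block_model_end\<close>)
qed

section \<open>Runs of the algorithm\<close>

text \<open>\<open>s\<close> stands for the length of a block step and \<alpha> for its step size.
  If \<open>s\<close> is large, the bound on \<alpha> suffices; if the quotient is large, the
  decrease is that quotient times \<open>s\<close>, and \<open>search\<close> bounds
  \<open>s\<close> from below.\<close>

lemma decrease_lower_bound:
  fixes s \<alpha> r e :: real
  assumes pos: "0 < n0" "0 < \<alpha>" "\<alpha> \<le> n5" "0 < a" "0 < e" "0 < c" "0 < am" "0 < r" "0 \<le> s"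
    and dec: "n0 * (s\<^sup>2 / \<alpha>) \<le> d"
    and large: "a \<le> s \<or> e \<le> s / \<alpha>" and search: "am \<le> \<alpha> \<or> c * r \<le> s"
  shows "min (n0 * (a\<^sup>2 / n5)) (n0 * (e * min (am * e) c)) * min 1 r \<le> d"
    (is "?k * ?r \<le> d")
proof -
  have "0 \<le> ?k" "0 \<le> ?r" "?r \<le> 1" "?r \<le> r" using pos by auto
  have k: "?k * ?r \<le> ?k"
    using \<open>0 \<le> ?k\<close> \<open>?r \<le> 1\<close> mult_left_mono[of ?r 1 ?k] by simp
  show ?thesis
  proof (cases "a \<le> s")
    case True
    have "a\<^sup>2 / n5 \<le> s\<^sup>2 / \<alpha>"
      using True pos by (intro frac_le power_mono) auto
    then have "n0 * (a\<^sup>2 / n5) \<le> n0 * (s\<^sup>2 / \<alpha>)"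
      using pos by (intro mult_left_mono) auto
    then show ?thesis using k dec by linarith
  next
    case False
    with large have e: "e \<le> s / \<alpha>" by simp
    have "min (am * e) c * ?r \<le> s"
      using search
    proof
      assume "am \<le> \<alpha>"
      then have "am * e \<le> \<alpha> * (s / \<alpha>)"
        using e pos by (intro mult_mono) auto
      then have "am * e \<le> s" using pos by simp
      moreover have "min (am * e) c * ?r \<le> am * e * 1"
        using pos by (intro mult_mono) auto
      ultimately show ?thesis by simp
    next
      assume "c * r \<le> s"
      moreover have "min (am * e) c * ?r \<le> c * r"
        using pos by (intro mult_mono) auto
      ultimately show ?thesis by simp
    qed
    then have "e * (min (am * e) c * ?r) \<le> s / \<alpha> * s"
      using e pos by (intro mult_mono) auto
    then have "n0 * (e * (min (am * e) c * ?r)) \<le> n0 * (s / \<alpha> * s)"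
      using pos by (intro mult_left_mono) auto
    moreover have "?k * ?r \<le> n0 * (e * min (am * e) c) * ?r"
      using \<open>0 \<le> ?r\<close> by (intro mult_right_mono) auto
    ultimately show ?thesis using dec by (simp add: power2_eq_square mult_ac)
  qed
qed

section \<open>Setting of a run and elementary properties of its sequences\<close>

locale trap =
  fixes K :: nat and blk :: "'n::finite \<Rightarrow> nat" and nc :: "nat \<Rightarrow> nat"
    and \<omega> :: "nat \<Rightarrow> nat \<Rightarrow> real ^ 'n" and h :: "nat \<Rightarrow> nat \<Rightarrow> real"
    and L :: "real ^ 'n \<Rightarrow> real" and B :: "real ^ 'n \<Rightarrow> real ^ 'n ^ 'n"
    and p :: trap_params
    and x y z :: "nat \<Rightarrow> real ^ 'n" and \<Delta> :: "nat \<Rightarrow> real"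
    and \<Omega> :: "(real ^ 'n) set" and Bhat :: real
  assumes blocks: "\<forall>j. blk j \<in> {1..K}"
    and Omega: "\<Omega> = feasible_set K blk nc \<omega> h"
    and params: "valid_params p"
    and B_symmetric: "\<forall>v\<in>\<Omega>. transpose (B v) = B v"
    and run: "trap_run p K blk nc \<omega> h L B x y z \<Delta>"
    and bounded_below: "bdd_below (L ` {v \<in> \<Omega>. L v \<le> L (x 0)})"
    and differentiable: "\<And>v. v \<in> \<Omega> \<Longrightarrow> L differentiable at v"
    and gradient_uc: "uniformly_continuous_on \<Omega> (gradient L)"
    and B_bounded: "Bhat > 0" "\<forall>v\<in>\<Omega>. onorm ((*v) (B v)) \<le> Bhat"
begin

abbreviation P where "P \<equiv> block_polyhedron blk nc \<omega> h"
abbreviation m where "m l \<equiv> model L B (x l)"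
abbreviation predicted where "predicted l \<equiv> m l (x l) - m l (y l)"

lemma convex_Omega: "convex \<Omega>" and closed_Omega: "closed \<Omega>"
  by (simp_all add: Omega convex_feasible_set closed_feasible_set)

lemma mem_Omega_iff: "v \<in> \<Omega> \<longleftrightarrow> (\<forall>k\<in>{1..K}. block blk k v \<in> P k)"
  by (simp add: Omega feasible_set_def)

lemma param_facts:
  "0 < \<sigma>\<^sub>1 p" "\<sigma>\<^sub>1 p < \<sigma>\<^sub>2 p" "\<sigma>\<^sub>2 p < 1" "1 < \<sigma>\<^sub>3 p" "0 < \<eta>\<^sub>1 p" "\<eta>\<^sub>1 p < \<eta>\<^sub>2 p" "\<eta>\<^sub>2 p < 1"
  "0 < \<gamma>\<^sub>1 p" "\<gamma>\<^sub>1 p < 1" "0 < \<gamma>\<^sub>2 p" "0 < \<nu>\<^sub>0 p" "\<nu>\<^sub>0 p < 1" "0 < \<nu>\<^sub>1 p" "0 < \<nu>\<^sub>3 p" "0 < \<nu>\<^sub>4 p"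
  "0 < \<nu>\<^sub>5 p"
  using params by (auto simp: valid_params_def)

lemma cauchy: "cauchy_point p K blk P (m l) (x l) (\<Delta> l) (z l)"
  and y_mem: "y l \<in> \<Omega>"
  and predicted_ge: "\<gamma>\<^sub>1 p * (m l (x l) - m l (z l)) \<le> predicted l"
  and infnorm_step_le: "infnorm (y l - x l) \<le> \<gamma>\<^sub>2 p * \<Delta> l"
  and update: "trap_update p L (m l) (x l) (\<Delta> l) (y l) (x (Suc l)) (\<Delta> (Suc l))"
  and start: "x 0 \<in> \<Omega>" "\<Delta> 0 > 0"
  using run by (auto simp: trap_run_def Let_def refinement_def Omega)

lemma update_cases:
  obtains (rejected) "x (Suc l) = x l" "\<sigma>\<^sub>1 p * \<Delta> l \<le> \<Delta> (Suc l)" "\<Delta> (Suc l) \<le> \<sigma>\<^sub>2 p * \<Delta> l"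
      "(L (x l) - L (y l)) / predicted l \<le> \<eta>\<^sub>2 p"
  | (accepted) "x (Suc l) = y l" "\<Delta> (Suc l) \<le> \<sigma>\<^sub>3 p * \<Delta> l"
      "\<sigma>\<^sub>1 p * \<Delta> l \<le> \<Delta> (Suc l) \<or> \<Delta> l \<le> \<Delta> (Suc l)"
      "\<eta>\<^sub>1 p \<le> (L (x l) - L (y l)) / predicted l"
proof -
  let ?\<rho> = "(L (x l) - L (y l)) / predicted l"
  consider "?\<rho> < \<eta>\<^sub>1 p" | "?\<rho> \<in> {\<eta>\<^sub>1 p..\<eta>\<^sub>2 p}" | "?\<rho> > \<eta>\<^sub>2 p"
    by fastforce
  then show thesis
    using update[of l] param_facts(6) unfolding trap_update_def Let_def
    by cases (auto intro: rejected accepted)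
qed

lemma very_successful: "\<eta>\<^sub>2 p < (L (x l) - L (y l)) / predicted l \<Longrightarrow> \<Delta> l \<le> \<Delta> (Suc l)"
  using update[of l] unfolding trap_update_def Let_def by auto

lemma radius_pos: "0 < \<Delta> l"
proof (induction l)
  case (Suc l)
  then have "0 < \<sigma>\<^sub>1 p * \<Delta> l" using param_facts by simp
  with Suc show ?case by (cases rule: update_cases[of l]) auto
qed (fact start)

lemma x_mem: "x l \<in> \<Omega>"
proof (induction l)
  case (Suc l)
  then show ?case by (cases rule: update_cases[of l]) (auto simp: y_mem)
qed (fact start)

text \<open>Collects what a step size of block \<open>k\<close> provides, as a predicate in
  \<alpha>, so that step sizes for all blocks can be chosen as one function.\<close>

definition block_step :: "nat \<Rightarrow> nat \<Rightarrow> real \<Rightarrow> bool" where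
  "block_step l k \<alpha> \<longleftrightarrow> 0 < \<alpha> \<and> \<alpha> \<le> \<nu>\<^sub>5 p \<and>
     block blk k (z l) =
       closest_point (P k) (block blk k (x l) - \<alpha> *\<^sub>R stage_gradient blk k L B (z l) (x l)) \<and>
     \<nu>\<^sub>0 p * ((norm (block blk k (z l - x l)))\<^sup>2 / \<alpha>) \<le>
       m l (alternating_point blk k (z l) (x l)) - m l (alternating_point blk (Suc k) (z l) (x l)) \<and>
     (min (\<nu>\<^sub>4 p) (2 * \<nu>\<^sub>3 p * (1 - \<nu>\<^sub>0 p) / Bhat) \<le> \<alpha> \<or>
       min 1 (\<nu>\<^sub>3 p) * (\<nu>\<^sub>1 p * \<Delta> l) \<le> norm (block blk k (z l - x l)))"

lemma block_steps_exist:
  obtains \<alpha> where "\<And>k. k \<in> {1..K} \<Longrightarrow> block_step l k (\<alpha> k)"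
proof -
  have "\<exists>\<alpha>. block_step l k \<alpha>" if k: "k \<in> {1..K}" for k
  proof -
    have "P k \<subseteq> block_space blk k" by (auto simp: block_polyhedron_def)
    moreover have "block blk k (x l) \<in> P k" using x_mem k by (simp add: mem_Omega_iff)
    moreover have "transpose (B (x l)) = B (x l)" "onorm ((*v) (B (x l))) \<le> Bhat"
      using x_mem B_symmetric B_bounded by auto
    ultimately show ?thesis
      unfolding block_step_def
      using cauchy_point_step[of p k K blk P L B "x l" "\<Delta> l" "z l" Bhat, OF params k cauchy _ _ B_bounded(1)
          convex_block_polyhedron closed_block_polyhedron]
      by metis
  qed
  then show thesis using that by metis
qed

lemma z_mem: "z l \<in> \<Omega>"
  unfolding mem_Omega_iff
proof
  fix k assume k: "k \<in> {1..K}"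
  then have "P k \<noteq> {}" using x_mem[of l] by (auto simp: mem_Omega_iff)
  then have "closest_point (P k) u \<in> P k" for u
    by (intro closest_point_in_set closed_block_polyhedron)
  with k show "block blk k (z l) \<in> P k"
    using block_steps_exist[of l] unfolding block_step_def by metis
qed

text \<open>Each summand of \<open>a\<close> is, up to the factor \<open>1 / \<alpha> k\<close>, the
  residual of the projection defining block \<open>k\<close> of \<open>z l\<close>; the sum is thus
  normal to \<Omega> at \<open>z l\<close>. The other terms pay for evaluating the gradient at
  \<open>x l\<close> and for the blocks moved earlier in the sweep.\<close>

lemma projected_gradient_le:
  assumes steps: "\<And>k. k \<in> {1..K} \<Longrightarrow> block_step l k (\<alpha> k)"
  shows "norm (projected_gradient L \<Omega> (z l)) \<le>
    (\<Sum>k=1..K. norm (block blk k (z l - x l)) / \<alpha> k +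
      (norm (gradient L (z l) - gradient L (x l)) + Bhat * norm (z l - x l)))"
proof -
  let ?G = "\<lambda>k. stage_gradient blk k L B (z l) (x l)"
  let ?w = "\<lambda>k. alternating_point blk k (z l) (x l)"
  let ?s = "\<lambda>k. block blk k (z l - x l)"
  note \<alpha> = steps[unfolded block_step_def]
  define a where "a = (\<Sum>k=1..K. - (1 / \<alpha> k) *\<^sub>R ?s k - ?G k)"
  have [simp]: "block blk k (?G k) = ?G k" for k
    by (simp add: stage_gradient_def)
  have "a \<bullet> (w - z l) \<le> 0" if w: "w \<in> \<Omega>" for w
  proof -
    have "(- (1 / \<alpha> k) *\<^sub>R ?s k - ?G k) \<bullet> (w - z l) \<le> 0" if k: "k \<in> {1..K}" for k
    proof -
      let ?v = "- (1 / \<alpha> k) *\<^sub>R ?s k - ?G k"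
      have "?v \<bullet> (w - z l) = ?v \<bullet> (block blk k w - block blk k (z l))"
      proof -
        have "?v = block blk k ?v" by (simp add: block_diff block_scale block_minus)
        then have "?v \<bullet> (w - z l) = ?v \<bullet> block blk k (w - z l)"
          by (metis inner_block_left)
        then show ?thesis by (simp add: block_diff)
      qed
      also have "\<dots> = (1 / \<alpha> k) * ((block blk k (x l) - \<alpha> k *\<^sub>R ?G k - block blk k (z l)) \<bullet>
          (block blk k w - block blk k (z l)))"
      proof -
        have "?v = (1 / \<alpha> k) *\<^sub>R (block blk k (x l) - \<alpha> k *\<^sub>R ?G k - block blk k (z l))"
          using \<alpha>[OF k] by (simp add: block_diff scaleR_diff_right)
        then show ?thesis by simp
      qed
      also have "\<dots> \<le> 0"
      proof (rule mult_nonneg_nonpos)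
        have cz: "block blk k (z l) =
            closest_point (P k) (block blk k (x l) - \<alpha> k *\<^sub>R ?G k)"
          using \<alpha>[OF k] by simp
        have "block blk k w \<in> P k" using w k by (simp add: mem_Omega_iff)
        then show "(block blk k (x l) - \<alpha> k *\<^sub>R ?G k - block blk k (z l)) \<bullet>
            (block blk k w - block blk k (z l)) \<le> 0"
          unfolding cz by (rule closest_point_dot[OF convex_block_polyhedron closed_block_polyhedron])
      qed (use \<alpha>[OF k] in auto)
      finally show ?thesis .
    qed
    then show ?thesis unfolding a_def inner_sum_left by (rule sum_nonpos)
  qed
  then have "norm (projected_gradient L \<Omega> (z l)) \<le> norm (- gradient L (z l) - a)"
    by (rule norm_projected_gradient_le[OF convex_Omega z_mem])
  \<comment> \<open>A vector is the sum of its blocks, so the error can be estimated block by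
    block.\<close>
  also have "- gradient L (z l) - a =
      (\<Sum>k=1..K. block blk k (- gradient L (z l)) - (- (1 / \<alpha> k) *\<^sub>R ?s k - ?G k))"
    unfolding a_def sum_subtractf by (simp only: sum_block[OF blocks])
  also have "norm \<dots> \<le> (\<Sum>k=1..K. norm (?s k) / \<alpha> k +
      (norm (gradient L (z l) - gradient L (x l)) + Bhat * norm (z l - x l)))"
  proof (rule sum_norm_le)
    fix k assume k: "k \<in> {1..K}"
    have "block blk k (- gradient L (z l)) - (- (1 / \<alpha> k) *\<^sub>R ?s k - ?G k) =
        (1 / \<alpha> k) *\<^sub>R ?s k +
        (block blk k (gradient L (x l) - gradient L (z l)) + block blk k (B (x l) *v (?w k - x l)))"
      by (simp add: stage_gradient_def block_diff block_add block_minus)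
    also have "norm \<dots> \<le> norm ((1 / \<alpha> k) *\<^sub>R ?s k) +
        (norm (gradient L (x l) - gradient L (z l)) + norm (B (x l) *v (?w k - x l)))"
      by (intro norm_triangle_mono order_refl norm_block_le)
    also have "norm ((1 / \<alpha> k) *\<^sub>R ?s k) = norm (?s k) / \<alpha> k"
      using \<alpha>[OF k] by simp
    also have "norm (B (x l) *v (?w k - x l)) \<le> Bhat * norm (?w k - x l)"
      using B_bounded(2) x_mem by (intro norm_matrix_mult_le) auto
    also have "\<dots> \<le> Bhat * norm (z l - x l)"
      using B_bounded(1) by (intro mult_left_mono norm_alternating_point_diff_le) auto
    finally show "norm (block blk k (- gradient L (z l)) - (- (1 / \<alpha> k) *\<^sub>R ?s k - ?G k)) \<le>
        norm (?s k) / \<alpha> k + (norm (gradient L (z l) - gradient L (x l)) + Bhat * norm (z l - x l))"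
      by (simp add: norm_minus_commute)
  qed
  finally show ?thesis .
qed

lemma K_pos: "0 < K"
  using blocks by (metis atLeastAtMost_iff gr0I not_one_le_zero order_trans)

text \<open>No stage increases the model, so the decrease of one stage is at most the telescoping
  sum over all stages.\<close>

lemma block_decrease_le:
  assumes steps: "\<And>k. k \<in> {1..K} \<Longrightarrow> block_step l k (\<alpha> k)"
    and k: "k \<in> {1..K}"
  shows "\<nu>\<^sub>0 p * ((norm (block blk k (z l - x l)))\<^sup>2 / \<alpha> k) \<le> m l (x l) - m l (z l)"
proof -
  let ?M = "\<lambda>k. m l (alternating_point blk k (z l) (x l))"
  note \<alpha> = steps[unfolded block_step_def]
  have "\<nu>\<^sub>0 p * ((norm (block blk k (z l - x l)))\<^sup>2 / \<alpha> k) \<le>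
      (\<Sum>k=1..K. \<nu>\<^sub>0 p * ((norm (block blk k (z l - x l)))\<^sup>2 / \<alpha> k))"
    using \<alpha> param_facts
    by (intro member_le_sum[OF k, of "\<lambda>k. \<nu>\<^sub>0 p * ((norm (block blk k (z l - x l)))\<^sup>2 / \<alpha> k)"])
      (auto intro!: mult_nonneg_nonneg divide_nonneg_pos)
  also have "\<dots> \<le> (\<Sum>k=1..K. ?M k - ?M (Suc k))"
    using \<alpha> by (intro sum_mono) auto
  also have "\<dots> = ?M 1 - ?M (Suc K)"
    using sum_Suc_diff[of 1 K "\<lambda>k. - ?M k"] K_pos by simp
  finally show ?thesis
    by (simp only: alternating_point_first[OF blocks] alternating_point_last[OF blocks])
qed

lemma cauchy_decrease_nonneg: "0 \<le> m l (x l) - m l (z l)"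
proof -
  obtain \<alpha> where \<alpha>: "\<And>k. k \<in> {1..K} \<Longrightarrow> block_step l k (\<alpha> k)"
    using block_steps_exist by blast
  have "1 \<in> {1..K}" using K_pos by auto
  moreover from this have "0 \<le> \<nu>\<^sub>0 p * ((norm (block blk 1 (z l - x l)))\<^sup>2 / \<alpha> 1)"
    using \<alpha> param_facts unfolding block_step_def
    by (intro mult_nonneg_nonneg divide_nonneg_pos) auto
  ultimately show ?thesis using block_decrease_le[OF \<alpha>, of 1] by simp
qed

lemma predicted_nonneg: "0 \<le> predicted l"
  using predicted_ge[of l] mult_nonneg_nonneg[OF less_imp_le[OF param_facts(8)] cauchy_decrease_nonneg]
  by (rule order_trans[rotated])

lemma accepted_decrease:
  assumes "\<eta>\<^sub>1 p \<le> (L (x l) - L (y l)) / predicted l"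
  shows "\<eta>\<^sub>1 p * predicted l \<le> L (x l) - L (y l)"
proof -
  \<comment> \<open>Division by 0 gives 0, which is below \<open>\<eta>\<^sub>1 p\<close>.\<close>
  have "predicted l \<noteq> 0" using assms param_facts(5) by auto
  then have "0 < predicted l" using predicted_nonneg[of l] by simp
  with assms show ?thesis by (simp add: pos_le_divide_eq)
qed

lemma decseq_L: "decseq (\<lambda>l. L (x l))"
proof (rule decseq_SucI)
  fix l
  show "L (x (Suc l)) \<le> L (x l)"
  proof (cases rule: update_cases[of l])
    case accepted
    have "0 \<le> \<eta>\<^sub>1 p * predicted l"
      using predicted_nonneg param_facts(5) by (simp add: mult_nonneg_nonneg)
    with accepted accepted_decrease[of l] show ?thesis by simp
  qed simp
qed

lemma L_bounded: obtains f0 where "\<And>l. f0 \<le> L (x l)"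
proof -
  obtain f0 where f0: "\<And>v. v \<in> \<Omega> \<Longrightarrow> L v \<le> L (x 0) \<Longrightarrow> f0 \<le> L v"
    using bounded_below by (auto simp: bdd_below_def)
  have "L (x l) \<le> L (x 0)" for l
    using decseq_L by (simp add: decseq_def)
  with f0 x_mem show thesis by (intro that) blast
qed

section \<open>Model error and Cauchy decrease, uniformly along the run\<close>

definition step_const :: real where "step_const = sqrt CARD('n) * \<gamma>\<^sub>2 p"

lemma step_const_pos: "0 < step_const"
  using param_facts by (simp add: step_const_def)

lemma norm_step_le: "norm (y l - x l) \<le> step_const * \<Delta> l"
proof -
  have "norm (y l - x l) \<le> sqrt CARD('n) * infnorm (y l - x l)"
    using norm_le_infnorm[of "y l - x l"] by simp
  also have "\<dots> \<le> sqrt CARD('n) * (\<gamma>\<^sub>2 p * \<Delta> l)"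
    by (intro mult_left_mono infnorm_step_le) auto
  finally show ?thesis by (simp add: step_const_def mult_ac)
qed

text \<open>Model and objective agree to first order at \<open>x l\<close>. Uniform continuity of
  the gradient and the bound on \<open>B\<close> make the error of smaller order than the radius,
  uniformly in \<open>l\<close>.\<close>

lemma model_accuracy:
  assumes "0 < e"
  obtains d where "0 < d" "\<And>l. \<Delta> l < d \<Longrightarrow> \<bar>(L (x l) - L (y l)) - predicted l\<bar> \<le> e * \<Delta> l"
proof -
  let ?c = step_const
  note c = step_const_pos
  \<comment> \<open>The linearisation error may use \<open>e / 2\<close> per unit of radius; the
    quadratic term uses the other half.\<close>
  define e' where "e' = e / (2 * ?c)"
  have "0 < e'" using assms c by (simp add: e'_def)
  then obtain t where t: "0 < t"
    "\<And>u v. u \<in> \<Omega> \<Longrightarrow> v \<in> \<Omega> \<Longrightarrow> dist v u < t \<Longrightarrow> dist (gradient L v) (gradient L u) < e'"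
    using gradient_uc unfolding uniformly_continuous_on_def by metis
  \<comment> \<open>The first bound keeps \<open>y l\<close> within \<open>t\<close> of
    \<open>x l\<close>; the second gives
    \<open>Bhat * ?c\<^sup>2 * \<Delta> l \<le> e\<close>.\<close>
  define d where "d = min (t / ?c) (e / (Bhat * ?c\<^sup>2))"
  have "0 < d" using t c assms B_bounded(1) by (simp add: d_def)
  moreover have "\<bar>(L (x l) - L (y l)) - predicted l\<bar> \<le> e * \<Delta> l" if "\<Delta> l < d" for l
  proof -
    let ?v = "y l - x l"
    have nv: "norm ?v \<le> ?c * \<Delta> l" by (rule norm_step_le)
    have "?c * \<Delta> l < t" using that c by (simp add: d_def field_simps)
    have seg: "closed_segment (x l) (y l) \<subseteq> \<Omega>"
      using x_mem y_mem convex_Omega by (simp add: closed_segment_subset)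
    have "\<bar>L (y l) - L (x l) - gradient L (x l) \<bullet> ?v\<bar> \<le> e' * norm ?v"
    proof (rule gradient_descent_error[OF convex_Omega x_mem y_mem differentiable])
      fix u assume u: "u \<in> closed_segment (x l) (y l)"
      have "dist u (x l) \<le> norm ?v"
        using segment_bound(1)[OF u] by (simp add: dist_norm)
      then have "dist u (x l) < t" using nv \<open>?c * \<Delta> l < t\<close> by linarith
      then show "norm (gradient L u - gradient L (x l)) \<le> e'"
        using t(2)[of "x l" u] u seg x_mem by (auto simp: dist_norm less_imp_le)
    qed
    also have "\<dots> \<le> e' * (?c * \<Delta> l)"
      using nv \<open>0 < e'\<close> by (intro mult_left_mono) auto
    also have "\<dots> = e / 2 * \<Delta> l" using c by (simp add: e'_def)
    finally have 1: "\<bar>L (y l) - L (x l) - gradient L (x l) \<bullet> ?v\<bar> \<le> e / 2 * \<Delta> l" .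
    have "\<bar>?v \<bullet> (B (x l) *v ?v)\<bar> \<le> Bhat * (norm ?v)\<^sup>2"
      using B_bounded x_mem by (intro quadratic_form_le) auto
    also have "\<dots> \<le> Bhat * (?c * \<Delta> l)\<^sup>2"
      using nv B_bounded by (intro mult_left_mono power_mono) auto
    also have "\<dots> = (Bhat * ?c\<^sup>2) * \<Delta> l * \<Delta> l" by (simp add: power2_eq_square)
    also have "\<dots> \<le> (Bhat * ?c\<^sup>2) * (e / (Bhat * ?c\<^sup>2)) * \<Delta> l"
      using that B_bounded radius_pos[of l] by (intro mult_right_mono mult_left_mono) (auto simp: d_def)
    also have "\<dots> = e * \<Delta> l" using c B_bounded(1) by simp
    finally have 2: "\<bar>?v \<bullet> (B (x l) *v ?v)\<bar> \<le> e * \<Delta> l" .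
    have "(L (x l) - L (y l)) - predicted l =
        - (L (y l) - L (x l) - gradient L (x l) \<bullet> ?v) + 1 / 2 * (?v \<bullet> (B (x l) *v ?v))"
      by (simp add: model_def)
    then show ?thesis using 1 2 by linarith
  qed
  ultimately show thesis by (rule that)
qed

text \<open>If every block had a short step and a small quotient, \<open>z l\<close> would be near
  \<open>x l\<close> and its projected gradient small. Hence some block is exceptional, and its
  decrease alone gives the bound, with \<kappa> independent of \<open>l\<close>.\<close>

lemma cauchy_decrease_bound:
  assumes "0 < \<epsilon>" "0 < \<delta>"
  obtains \<kappa> where "0 < \<kappa>"
    "\<And>l. \<delta> \<le> norm (z l - x l) \<or> \<epsilon> \<le> norm (projected_gradient L \<Omega> (z l)) \<Longrightarrow>
       \<kappa> * min 1 (\<Delta> l) \<le> m l (x l) - m l (z l)"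
proof -
  \<comment> \<open>Each of the \<open>K\<close> blocks contributes less than \<open>2 * e\<close>:
    \<open>e\<close> from the quotient, \<open>e / 2\<close> from the gradient change and
    \<open>e / 2\<close> from \<open>B\<close>.\<close>
  define e where "e = \<epsilon> / (2 * K)"
  have "0 < e" using assms K_pos by (simp add: e_def)
  obtain t where t: "0 < t"
    "\<And>u v. u \<in> \<Omega> \<Longrightarrow> v \<in> \<Omega> \<Longrightarrow> dist v u < t \<Longrightarrow> dist (gradient L v) (gradient L u) < e / 2"
    using gradient_uc \<open>0 < e\<close> unfolding uniformly_continuous_on_def by (metis half_gt_zero)
  \<comment> \<open>\<open>K\<close> block steps shorter than \<open>a\<close> sum to less than all
    three thresholds.\<close>
  define a where "a = min \<delta> (min t (e / (2 * Bhat))) / K"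
  have a: "0 < a" using assms t \<open>0 < e\<close> B_bounded(1) K_pos by (simp add: a_def)
  let ?am = "min (\<nu>\<^sub>4 p) (2 * \<nu>\<^sub>3 p * (1 - \<nu>\<^sub>0 p) / Bhat)" and ?c = "min 1 (\<nu>\<^sub>3 p) * \<nu>\<^sub>1 p"
  have pos: "0 < ?am" "0 < ?c" using param_facts B_bounded(1) by auto
  define \<kappa> where "\<kappa> = min (\<nu>\<^sub>0 p * (a\<^sup>2 / \<nu>\<^sub>5 p)) (\<nu>\<^sub>0 p * (e * min (?am * e) ?c))"
  have "0 < \<kappa>" using param_facts a \<open>0 < e\<close> pos unfolding \<kappa>_def
    by (auto simp: min_less_iff_conj)
  moreover have "\<kappa> * min 1 (\<Delta> l) \<le> m l (x l) - m l (z l)"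
    if hyp: "\<delta> \<le> norm (z l - x l) \<or> \<epsilon> \<le> norm (projected_gradient L \<Omega> (z l))" for l
  proof -
    obtain \<alpha> where steps: "\<And>k. k \<in> {1..K} \<Longrightarrow> block_step l k (\<alpha> k)"
      using block_steps_exist by blast
    note \<alpha> = steps[unfolded block_step_def]
    let ?s = "\<lambda>k. norm (block blk k (z l - x l))"
    have "\<exists>k\<in>{1..K}. a \<le> ?s k \<or> e \<le> ?s k / \<alpha> k"
    proof (rule ccontr)
      assume "\<not> ?thesis"
      then have small: "\<And>k. k \<in> {1..K} \<Longrightarrow> ?s k < a \<and> ?s k / \<alpha> k < e" by force
      have "norm (z l - x l) \<le> (\<Sum>k=1..K. ?s k)"
        using norm_sum[of "\<lambda>k. block blk k (z l - x l)" "{1..K}"] by (simp only: sum_block[OF blocks])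
      also have "\<dots> < (\<Sum>k=1..K. a)"
        using small K_pos by (intro sum_strict_mono) auto
      also have "\<dots> = min \<delta> (min t (e / (2 * Bhat)))"
        using K_pos by (simp add: a_def)
      finally have n: "norm (z l - x l) < \<delta>" "norm (z l - x l) < t" "norm (z l - x l) < e / (2 * Bhat)"
        by auto
      have g: "norm (gradient L (z l) - gradient L (x l)) < e / 2"
        using t(2)[OF x_mem z_mem, of l l] n(2) by (simp add: dist_norm)
      have b: "Bhat * norm (z l - x l) < e / 2"
        using n(3) B_bounded(1) by (simp add: field_simps)
      have "norm (projected_gradient L \<Omega> (z l)) \<le>
          (\<Sum>k=1..K. ?s k / \<alpha> k +
            (norm (gradient L (z l) - gradient L (x l)) + Bhat * norm (z l - x l)))"
        using steps by (rule projected_gradient_le)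
      also have "\<dots> < (\<Sum>k=1..K. 2 * e)"
        using small g b K_pos by (intro sum_strict_mono) (auto, fastforce)
      also have "\<dots> = \<epsilon>" using K_pos by (simp add: e_def)
      finally show False using hyp n(1) by linarith
    qed
    then obtain k where k: "k \<in> {1..K}" "a \<le> ?s k \<or> e \<le> ?s k / \<alpha> k" by blast
    have "\<nu>\<^sub>0 p * ((?s k)\<^sup>2 / \<alpha> k) \<le> m l (x l) - m l (z l)"
      using steps k(1) by (rule block_decrease_le)
    moreover have "?am \<le> \<alpha> k \<or> ?c * \<Delta> l \<le> ?s k"
      using \<alpha>[OF k(1)] by (simp add: mult.assoc)
    ultimately show ?thesis
      unfolding \<kappa>_def using \<alpha>[OF k(1)] param_facts a \<open>0 < e\<close> pos radius_pos[of l] k(2)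
      by (intro decrease_lower_bound[where s = "?s k" and \<alpha> = "\<alpha> k"]) auto
  qed
  ultimately show thesis by (rule that)
qed

text \<open>
  Otherwise the radii tend to 0 while the iterates stay near \<open>xs\<close>, where the predicted
  decrease is at least a multiple of the radius and hence dominates the model error, which is of
  smaller order; then all late steps are very successful and the radii no longer shrink.
\<close>

lemma projected_gradient_small_near_limit_point:
  assumes lim: "strict_mono \<phi>" "(\<lambda>i. x (\<phi> i)) \<longlonglongrightarrow> xs" and "0 < \<epsilon>"
  shows "\<exists>l\<ge>N. dist (z l) xs < \<epsilon> \<and> norm (projected_gradient L \<Omega> (z l)) < \<epsilon>"
proof (rule ccontr)
  assume "\<not> ?thesis"
  then have large: "\<And>l. N \<le> l \<Longrightarrow> dist (z l) xs < \<epsilon> \<Longrightarrow> \<epsilon> \<le> norm (projected_gradient L \<Omega> (z l))"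
    by force
  obtain \<kappa> where \<kappa>: "0 < \<kappa>"
    "\<And>l. \<epsilon> / 2 \<le> norm (z l - x l) \<or> \<epsilon> \<le> norm (projected_gradient L \<Omega> (z l)) \<Longrightarrow>
       \<kappa> * min 1 (\<Delta> l) \<le> m l (x l) - m l (z l)"
    using cauchy_decrease_bound[of \<epsilon> "\<epsilon> / 2"] \<open>0 < \<epsilon>\<close> by auto
  \<comment> \<open>For \<open>x l\<close> within \<open>\<epsilon> / 2\<close> of
    \<open>xs\<close>, either \<open>z l\<close> is at least \<open>\<epsilon> / 2\<close> away from
    \<open>x l\<close>, or it lies in the ball where \<open>large\<close> applies; \<kappa> serves
    both cases.\<close>
  have pred: "\<gamma>\<^sub>1 p * \<kappa> * min 1 (\<Delta> l) \<le> predicted l" if "N \<le> l" "dist (x l) xs < \<epsilon> / 2" for l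
  proof -
    have "\<epsilon> / 2 \<le> norm (z l - x l) \<or> dist (z l) xs < \<epsilon>"
      using that(2) dist_triangle[of "z l" xs "x l"] by (auto simp: dist_norm)
    then have "\<kappa> * min 1 (\<Delta> l) \<le> m l (x l) - m l (z l)"
      using \<kappa>(2) large that(1) by blast
    then have "\<gamma>\<^sub>1 p * (\<kappa> * min 1 (\<Delta> l)) \<le> \<gamma>\<^sub>1 p * (m l (x l) - m l (z l))"
      using param_facts(8) by (intro mult_left_mono) auto
    then show ?thesis using predicted_ge[of l] by (simp add: mult.assoc)
  qed
  obtain f0 where f0: "\<And>l. f0 \<le> L (x l)" using L_bounded by blast
  have step: "x (Suc l) = x l \<and> \<Delta> (Suc l) \<le> \<sigma>\<^sub>2 p * \<Delta> l \<or>
      norm (x (Suc l) - x l) \<le> step_const * \<Delta> l \<and> \<Delta> (Suc l) \<le> \<sigma>\<^sub>3 p * \<Delta> l \<and>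
      (N \<le> l \<longrightarrow> dist (x l) xs < \<epsilon> / 2 \<longrightarrow>
        \<eta>\<^sub>1 p * (\<gamma>\<^sub>1 p * \<kappa>) * min 1 (\<Delta> l) \<le> L (x l) - L (x (Suc l)))" for l
  proof (cases rule: update_cases[of l])
    case accepted
    have "\<eta>\<^sub>1 p * (\<gamma>\<^sub>1 p * \<kappa> * min 1 (\<Delta> l)) \<le> L (x l) - L (y l)"
      if "N \<le> l" "dist (x l) xs < \<epsilon> / 2"
      using mult_left_mono[OF pred[OF that] less_imp_le[OF param_facts(5)]]
        accepted_decrease[OF accepted(4)] by linarith
    then show ?thesis
      using accepted norm_step_le[of l] by (simp add: mult.assoc)
  qed simp
  have \<Delta>: "\<Delta> \<longlonglongrightarrow> 0" and near: "\<forall>\<^sub>F l in sequentially. dist (x l) xs < \<epsilon> / 2"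
    using trust_region_trapped[of \<Delta> "\<sigma>\<^sub>2 p" "\<sigma>\<^sub>3 p" step_const "\<eta>\<^sub>1 p * (\<gamma>\<^sub>1 p * \<kappa>)" "\<epsilon> / 2" "\<lambda>l. L (x l)" f0 x N xs \<phi>,
        OF radius_pos _ _ _ step_const_pos _ _ decseq_L f0 step lim]
      param_facts \<kappa>(1) \<open>0 < \<epsilon>\<close> by auto
  \<comment> \<open>Once \<open>\<Delta> l < 1\<close>, the model error is at most half of
    \<open>1 - \<eta>\<^sub>2 p\<close> times the lower bound in \<open>pred\<close>, so the ratio
    strictly exceeds \<open>\<eta>\<^sub>2 p\<close>.\<close>
  define e where "e = (1 - \<eta>\<^sub>2 p) * (\<gamma>\<^sub>1 p * \<kappa>) / 2"
  have "0 < e" using param_facts \<kappa>(1) by (simp add: e_def)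
  then obtain d where d: "0 < d"
    "\<And>l. \<Delta> l < d \<Longrightarrow> \<bar>(L (x l) - L (y l)) - predicted l\<bar> \<le> e * \<Delta> l"
    using model_accuracy by blast
  have "\<forall>\<^sub>F l in sequentially. \<Delta> l < min 1 d"
    using \<Delta> d(1) by (intro order_tendstoD(2)) auto
  then have "\<forall>\<^sub>F l in sequentially. \<Delta> l \<le> \<Delta> (Suc l)"
    using near eventually_ge_at_top[of N]
  proof eventually_elim
    case (elim l)
    have pl: "\<gamma>\<^sub>1 p * \<kappa> * \<Delta> l \<le> predicted l"
      using pred[of l] elim by simp
    moreover have "0 < \<gamma>\<^sub>1 p * \<kappa> * \<Delta> l"
      using param_facts \<kappa>(1) radius_pos[of l] by simp
    ultimately have "0 < predicted l" by linarith
    have "e * \<Delta> l < 2 * (e * \<Delta> l)"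
      using mult_pos_pos[OF \<open>0 < e\<close> radius_pos[of l]] by simp
    also have "2 * (e * \<Delta> l) = (1 - \<eta>\<^sub>2 p) * (\<gamma>\<^sub>1 p * \<kappa> * \<Delta> l)"
      by (simp add: e_def)
    also have "\<dots> \<le> (1 - \<eta>\<^sub>2 p) * predicted l"
      using pl param_facts by (intro mult_left_mono) auto
    finally have "predicted l - (L (x l) - L (y l)) < (1 - \<eta>\<^sub>2 p) * predicted l"
      using d(2)[of l] elim by auto
    then have "\<eta>\<^sub>2 p * predicted l < L (x l) - L (y l)"
      by (simp add: algebra_simps)
    then show ?case
      using \<open>0 < predicted l\<close> by (intro very_successful) (simp add: pos_less_divide_eq)
  qed
  then obtain M where M: "\<And>l. M \<le> l \<Longrightarrow> \<Delta> l \<le> \<Delta> (Suc l)"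
    by (auto simp: eventually_sequentially)
  \<comment> \<open>Positive radii that no longer shrink cannot tend to 0.\<close>
  have "\<Delta> M \<le> \<Delta> l" if "M \<le> l" for l
    using that by (induction l rule: dec_induct) (use M order_trans in blast)+
  then have "\<Delta> M \<le> 0"
    using \<Delta> by (intro Lim_bounded2[of \<Delta>]) auto
  then show False using radius_pos[of M] by simp
qed

end

text \<open>Dependent choice; letting \<open>Q\<close> depend on \<open>n\<close> allows the
  tolerance to shrink along the subsequence.\<close>

lemma frequently_imp_subsequence:
  assumes "\<And>n N::nat. \<exists>l\<ge>N. Q n l"
  obtains r :: "nat \<Rightarrow> nat" where "strict_mono r" "\<And>n. Q n (r n)"
proof -
  have "\<exists>r. \<forall>n. Q n (r n) \<and> r n < r (Suc n)"
    using assms by (intro dependent_nat_choice) (metis le_refl, metis Suc_le_eq)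
  then show thesis using that strict_mono_Suc_iff by blast
qed

theorem theorem4p1:
  fixes K :: nat and blk :: "'n::finite \<Rightarrow> nat" and nc :: "nat \<Rightarrow> nat"
    and \<omega> :: "nat \<Rightarrow> nat \<Rightarrow> real ^ 'n" and h :: "nat \<Rightarrow> nat \<Rightarrow> real"
    and L :: "real ^ 'n \<Rightarrow> real" and B :: "real ^ 'n \<Rightarrow> real ^ 'n ^ 'n"
    and p :: trap_params
    and x y z :: "nat \<Rightarrow> real ^ 'n" and \<Delta> :: "nat \<Rightarrow> real"
    and \<Omega> U :: "(real ^ 'n) set" and Bhat :: real and xstar :: "real ^ 'n"
  assumes blocks: "\<forall>j. blk j \<in> {1..K}"
    and normals: "\<forall>k\<in>{1..K}. \<forall>i\<in>{1..nc k}. \<omega> k i \<in> block_space blk k"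
    and nonempty: "\<forall>k\<in>{1..K}. block_polyhedron blk nc \<omega> h k \<noteq> {}"
    and Omega: "\<Omega> = feasible_set K blk nc \<omega> h"
    and params: "valid_params p"
    and B_symmetric: "\<forall>v\<in>\<Omega>. transpose (B v) = B v"
    and run: "trap_run p K blk nc \<omega> h L B x y z \<Delta>"
    and not_critical: "\<forall>l. \<not> critical_point L \<Omega> (x l)"
    and bounded_below: "bdd_below (L ` {v \<in> \<Omega>. L v \<le> L (x 0)})"
    and U: "open U" "\<Omega> \<subseteq> U"
    and C1: "\<forall>v\<in>U. L differentiable at v" "continuous_on U (gradient L)"
    and gradient_uc: "uniformly_continuous_on \<Omega> (gradient L)"
    and B_bounded: "Bhat > 0" "\<forall>v\<in>\<Omega>. onorm ((*v) (B v)) \<le> Bhat"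
    and limit_point: "\<exists>r :: nat \<Rightarrow> nat. strict_mono r \<and> (\<lambda>i. x (r i)) \<longlonglongrightarrow> xstar"
  shows "(\<exists>r :: nat \<Rightarrow> nat. strict_mono r \<and>
            (\<lambda>i. norm (projected_gradient L \<Omega> (z (r i)))) \<longlonglongrightarrow> 0 \<and>
            (\<lambda>i. z (r i)) \<longlonglongrightarrow> xstar) \<and>
         critical_point L \<Omega> xstar"
proof -
  interpret trap K blk nc \<omega> h L B p x y z \<Delta> \<Omega> Bhat
    using blocks Omega params B_symmetric run bounded_below U C1 gradient_uc B_bounded
    by unfold_locales auto
  obtain \<phi> where \<phi>: "strict_mono \<phi>" "(\<lambda>i. x (\<phi> i)) \<longlonglongrightarrow> xstar"
    using limit_point by blast
  \<comment> \<open>The tolerance \<epsilon> is taken to be \<open>1 / Suc n\<close> at position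
    \<open>n\<close>, which yields both limits along one subsequence.\<close>
  obtain r where r: "strict_mono r"
    "\<And>n. dist (z (r n)) xstar < 1 / Suc n \<and> norm (projected_gradient L \<Omega> (z (r n))) < 1 / Suc n"
    by (rule frequently_imp_subsequence[of "\<lambda>n l. dist (z l) xstar < 1 / Suc n \<and>
          norm (projected_gradient L \<Omega> (z l)) < 1 / Suc n"])
      (use projected_gradient_small_near_limit_point[OF \<phi>] in auto)
  have inv: "(\<lambda>n. 1 / real (Suc n)) \<longlonglongrightarrow> 0"
    using LIMSEQ_inverse_real_of_nat by (simp add: inverse_eq_divide)
  have le: "norm (projected_gradient L \<Omega> (z (r i))) \<le> 1 / real (Suc i)"
    "dist (z (r i)) xstar \<le> 1 / real (Suc i)" for i
    using r(2)[of i] by (simp_all only: less_imp_le)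
  have pg: "(\<lambda>i. norm (projected_gradient L \<Omega> (z (r i)))) \<longlonglongrightarrow> 0"
    by (rule tendsto_sandwich[OF always_eventually always_eventually tendsto_const inv];
        intro allI norm_ge_zero le)
  have "(\<lambda>i. dist (z (r i)) xstar) \<longlonglongrightarrow> 0"
    by (rule tendsto_sandwich[OF always_eventually always_eventually tendsto_const inv];
        intro allI zero_le_dist le)
  then have zl: "(\<lambda>i. z (r i)) \<longlonglongrightarrow> xstar"
    by (rule tendsto_dist_iff[THEN iffD2])
  have "critical_point L \<Omega> xstar"
    using critical_point_limit[OF convex_Omega closed_Omega z_mem zl pg] C1(2) U(2)
      continuous_on_subset by blast
  with r(1) pg zl show ?thesis by blast
qed

end
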